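(* Let $\mathcal{A}_{*,*}$ be the dual motivic Steenrod algebra over $\operatorname{Spec}\mathbb{C}$ at the prime $2$, a bigraded Hopf algebra over $\mathbb{M}_2=\mathbb{F}_2[\tau]$. A quotient Hopf algebra of $\mathcal{A}_{*,*}$ is free as an $\mathbb{M}_2$-module if and only if it is of the form $B_{*,*}(h,k)=\mathcal{A}_{*,*}/I(h,k)$ for a free profile function $(h,k)$ satisfying the following two conditions: (1) for all $i,j\ge 1$, $h(i)\le j+h(i+j)$ or $h(j)\le h(i+j)$; (2) for all $i\ge 1$, $j\ge 0$, $h(i)\le j+k(i+j)$ or $k(j)\le k(i+j)$.
   Context: $\mathbb{M}_2=\mathbb{F}_2[\tau]$ is the motivic cohomology of a point. The dual motivic Steenrod algebra is the bigraded (homologically graded) commutative Hopf algebra over $\mathbb{M}_2$ $$\mathcal{A}_{*,*}=\mathbb{M}_2[\tau_i,\xi_{i+1}\mid i\ge 0]/(\tau_i^2+\tau\xi_{i+1}),$$ with $|\xi_i|=(2^{i+1}-2,2^i-1)$, $|\tau_i|=(2^{i+1}-1,2^i-1)$, $|\tau|=(0,-1)$, and coproduct (with $\xi_0=1$) $\psi(\xi_k)=\sum_{i=0}^k\xi_{k-i}^{2^i}\otimes\xi_i$, $\psi(\tau_k)=\tau_k\otimes 1+\sum_{i=0}^k\xi_{k-i}^{2^i}\otimes\tau_i$. Ideals and quotients are bigraded. A profile function is a pair $(h,k)$ of functions $h:\{1,2,3,\dots\}\to\{0,1,2,\dots,\infty\}$ and $k:\{0,1,2,\dots\}\to\{0,1,2,\dots,\infty\}$.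 $I(h,k)\subset\mathcal{A}_{*,*}$ is the ideal generated by $\xi_i^{2^{h(i)}}$ ($i\ge1$) and $\tau_j^{2^{k(j)}}$ ($j\ge 0$), where no generator is imposed when the corresponding value $h(i)$ or $k(j)$ is $\infty$; and $B_{*,*}(h,k)=\mathcal{A}_{*,*}/I(h,k)$. A profile function $(h,k)$ is free if for all $i\ge 0$: $h(i+1)\le k(i)-1$ when $k(i)\neq 0$, and $h(i+1)=0$ when $k(i)=0$ (with $\infty-1=\infty$). *)

theory Defs
  imports
    "HOL-Library.Poly_Mapping"
    "HOL-Library.Z2"
    "HOL-Library.Extended_Nat"
    "HOL-Computational_Algebra.Polynomial"
begin

subsection \<open>Ideals and quotient modules\<close>

text \<open>
  A commutative ring is a module over itself; its submodules are its ideals.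
\<close>

lemma module_times: "module ((*) :: 'a::comm_ring_1 \<Rightarrow> 'a \<Rightarrow> 'a)"
  by unfold_locales (simp_all add: algebra_simps)

abbreviation is_ideal :: "'a::comm_ring_1 set \<Rightarrow> bool"
  where "is_ideal \<equiv> module.subspace (*)"

abbreviation ideal_gen :: "'a::comm_ring_1 set \<Rightarrow> 'a set"
  where "ideal_gen \<equiv> module.span (*)"

text \<open>
  For a submodule \<open>N\<close>, the quotient by \<open>N\<close> is free: there is a set \<open>B\<close> whose residue classes
  modulo \<open>N\<close> generate the quotient and are linearly independent. Independence is formulated for
  representatives; it forces different elements of \<open>B\<close> to have different residue classes.
\<close>

definition free_quotient :: "('r::comm_ring_1 \<Rightarrow> 'a::ab_group_add \<Rightarrow> 'a) \<Rightarrow> 'a set \<Rightarrow> bool"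
  where "free_quotient scale N \<longleftrightarrow>
    (\<exists>B. (\<forall>x. \<exists>F c. finite F \<and> F \<subseteq> B \<and> x - (\<Sum>b\<in>F. scale (c b) b) \<in> N) \<and>
         (\<forall>F c. finite F \<and> F \<subseteq> B \<and> (\<Sum>b\<in>F. scale (c b) b) \<in> N \<longrightarrow> (\<forall>b\<in>F. c b = 0)))"


subsection \<open>The algebra and its tensor powers\<close>

text \<open>
  The ground ring \<open>F\<^sub>2[\<tau>]\<close> is \<^typ>\<open>bit poly\<close>, with \<open>\<tau>\<close> the polynomial variable.
  \<open>Tau i\<close> is the generator \<open>\<tau>\<^sub>i\<close>, and \<open>Xi i\<close> is the generator \<open>\<xi>\<^sub>i\<^sub>+\<^sub>1\<close> (so that the
  indices of both families start at \<open>0\<close>).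
\<close>

type_synonym M2 = "bit poly"

definition tau :: M2
  where "tau = [:0, 1:]"

datatype gen = Tau nat | Xi nat

text \<open>
  Polynomials over \<open>F\<^sub>2[\<tau>]\<close> in one copy of the generators for every \<open>s :: 's\<close>. Dividing out
  the relations in every copy yields, for a finite type \<open>'s\<close>, the tensor power over \<open>F\<^sub>2[\<tau>]\<close>
  of the dual motivic Steenrod algebra with one factor for every \<open>s\<close>. The algebra itself is
  the case of \<^typ>\<open>unit\<close>, and its tensor square is the case of \<^typ>\<open>bool\<close>.
\<close>

type_synonym 's free_alg = "(('s \<times> gen) \<Rightarrow>\<^sub>0 nat) \<Rightarrow>\<^sub>0 M2"

definition Const :: "M2 \<Rightarrow> 's free_alg"
  where "Const c = Poly_Mapping.single 0 c"

definition Var :: "'s \<Rightarrow> gen \<Rightarrow> 's free_alg"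
  where "Var s g = Poly_Mapping.single (Poly_Mapping.single (s, g) 1) 1"

definition relations :: "'s free_alg set"
  where "relations = {Var s (Tau i) ^ 2 + Const tau * Var s (Xi i) | s i. True}"


text \<open>Evaluation of polynomials in an algebra with structure map \<open>\<phi>\<close>.\<close>

definition eval_monom :: "('s \<times> gen \<Rightarrow> 'r::comm_ring_1) \<Rightarrow> (('s \<times> gen) \<Rightarrow>\<^sub>0 nat) \<Rightarrow> 'r"
  where "eval_monom f m = (\<Prod>v\<in>Poly_Mapping.keys m. f v ^ Poly_Mapping.lookup m v)"

definition eval_poly :: "(M2 \<Rightarrow> 'r) \<Rightarrow> ('s \<times> gen \<Rightarrow> 'r::comm_ring_1) \<Rightarrow> 's free_alg \<Rightarrow> 'r"
  where "eval_poly \<phi> f p =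
    (\<Sum>m\<in>Poly_Mapping.keys p. \<phi> (Poly_Mapping.lookup p m) * eval_monom f m)"

definition is_ring_hom :: "('a::comm_ring_1 \<Rightarrow> 'b::comm_ring_1) \<Rightarrow> bool"
  where "is_ring_hom \<phi> \<longleftrightarrow>
    \<phi> 1 = 1 \<and> (\<forall>x y. \<phi> (x + y) = \<phi> x + \<phi> y) \<and> (\<forall>x y. \<phi> (x * y) = \<phi> x * \<phi> y)"

lemma is_ring_homD:
  assumes "is_ring_hom \<phi>"
  shows "\<phi> 1 = 1" "\<phi> (x + y) = \<phi> x + \<phi> y" "\<phi> (x * y) = \<phi> x * \<phi> y"
    "\<phi> 0 = 0" "\<phi> (x ^ n) = \<phi> x ^ n" "\<phi> (sum g S) = (\<Sum>i\<in>S. \<phi> (g i))"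
    "\<phi> (- x) = - \<phi> x" "\<phi> (x - y) = \<phi> x - \<phi> y"
proof -
  show one: "\<phi> 1 = 1" and add: "\<phi> (x + y) = \<phi> x + \<phi> y" and mult: "\<phi> (x * y) = \<phi> x * \<phi> y" for x y
    using assms by (auto simp: is_ring_hom_def)
  show zero: "\<phi> 0 = 0" using add[of 0 0] by simp
  show "\<phi> (x ^ n) = \<phi> x ^ n" by (induction n) (simp_all add: one mult)
  show "\<phi> (sum g S) = (\<Sum>i\<in>S. \<phi> (g i))"
    by (induction S rule: infinite_finite_induct) (simp_all add: zero add)
  show neg: "\<phi> (- x) = - \<phi> x" for x
    using add[of x "- x"] zero by (simp add: eq_neg_iff_add_eq_0 add.commute)
  show "\<phi> (x - y) = \<phi> x - \<phi> y"
    using add[of x "- y"] neg by simp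
qed

lemma eval_monom_superset:
  assumes "finite S" "Poly_Mapping.keys m \<subseteq> S"
  shows "eval_monom f m = (\<Prod>v\<in>S. f v ^ Poly_Mapping.lookup m v)"
  unfolding eval_monom_def
  by (rule prod.mono_neutral_left) (use assms in \<open>auto simp: in_keys_iff\<close>)

lemma eval_monom_add: "eval_monom f (m + n) = eval_monom f m * eval_monom f n"
proof -
  let ?S = "Poly_Mapping.keys m \<union> Poly_Mapping.keys n"
  have "eval_monom f (m + n) = (\<Prod>v\<in>?S. f v ^ Poly_Mapping.lookup (m + n) v)"
    by (rule eval_monom_superset) (use Poly_Mapping.keys_add[of m n] in auto)
  also have "\<dots> = (\<Prod>v\<in>?S. f v ^ Poly_Mapping.lookup m v) *
      (\<Prod>v\<in>?S. f v ^ Poly_Mapping.lookup n v)"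
    by (simp add: lookup_add power_add prod.distrib)
  also have "\<dots> = eval_monom f m * eval_monom f n"
    by (simp add: eval_monom_superset[symmetric])
  finally show ?thesis .
qed

lemma eval_poly_superset:
  assumes "is_ring_hom \<phi>" "finite S" "Poly_Mapping.keys p \<subseteq> S"
  shows "eval_poly \<phi> f p = (\<Sum>m\<in>S. \<phi> (Poly_Mapping.lookup p m) * eval_monom f m)"
  unfolding eval_poly_def
  by (rule sum.mono_neutral_left)
     (use assms in \<open>auto simp: in_keys_iff is_ring_homD\<close>)

lemma eval_poly_add:
  assumes "is_ring_hom \<phi>"
  shows "eval_poly \<phi> f (p + q) = eval_poly \<phi> f p + eval_poly \<phi> f q"
proof -
  let ?S = "Poly_Mapping.keys p \<union> Poly_Mapping.keys q"
  have "eval_poly \<phi> f (p + q) =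
      (\<Sum>m\<in>?S. \<phi> (Poly_Mapping.lookup (p + q) m) * eval_monom f m)"
    by (rule eval_poly_superset) (use Poly_Mapping.keys_add[of p q] assms in auto)
  also have "\<dots> = (\<Sum>m\<in>?S. \<phi> (Poly_Mapping.lookup p m) * eval_monom f m) +
      (\<Sum>m\<in>?S. \<phi> (Poly_Mapping.lookup q m) * eval_monom f m)"
    by (simp add: lookup_add is_ring_homD[OF assms] algebra_simps sum.distrib)
  also have "\<dots> = eval_poly \<phi> f p + eval_poly \<phi> f q"
    using assms by (simp add: eval_poly_superset[symmetric])
  finally show ?thesis .
qed

lemma eval_poly_single:
  assumes "is_ring_hom \<phi>"
  shows "eval_poly \<phi> f (Poly_Mapping.single m c) = \<phi> c * eval_monom f m"
  by (subst eval_poly_superset[where S = "{m}"]) (use assms in auto)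

lemma eval_poly_sum:
  assumes "is_ring_hom \<phi>"
  shows "eval_poly \<phi> f (sum g S) = (\<Sum>i\<in>S. eval_poly \<phi> f (g i))"
  by (induction S rule: infinite_finite_induct)
     (simp_all add: eval_poly_add[OF assms] eval_poly_def[of _ _ 0])

lemma poly_mapping_sum_single:
  "p = (\<Sum>m\<in>Poly_Mapping.keys p. Poly_Mapping.single m (Poly_Mapping.lookup p m))"
  by (rule poly_mapping_eqI) (auto simp: lookup_sum lookup_single when_def in_keys_iff sum.delta)

lemma eval_poly_mult:
  assumes "is_ring_hom \<phi>"
  shows "eval_poly \<phi> f (p * q) = eval_poly \<phi> f p * eval_poly \<phi> f q"
proof -
  let ?m = "\<lambda>p m. Poly_Mapping.single m (Poly_Mapping.lookup p m)"
  have "p * q = (\<Sum>m\<in>Poly_Mapping.keys p. ?m p m) * (\<Sum>n\<in>Poly_Mapping.keys q. ?m q n)"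
    by (simp add: poly_mapping_sum_single[symmetric])
  also have "\<dots> = (\<Sum>m\<in>Poly_Mapping.keys p. \<Sum>n\<in>Poly_Mapping.keys q.
      Poly_Mapping.single (m + n) (Poly_Mapping.lookup p m * Poly_Mapping.lookup q n))"
    by (simp add: sum_product mult_single)
  finally have "eval_poly \<phi> f (p * q) = (\<Sum>m\<in>Poly_Mapping.keys p. \<Sum>n\<in>Poly_Mapping.keys q.
      (\<phi> (Poly_Mapping.lookup p m) * eval_monom f m) *
      (\<phi> (Poly_Mapping.lookup q n) * eval_monom f n))"
    by (simp add: eval_poly_sum[OF assms] eval_poly_single[OF assms] eval_monom_add
        is_ring_homD[OF assms] algebra_simps)
  then show ?thesis
    by (simp add: eval_poly_def sum_product)
qed

lemma eval_poly_is_ring_hom: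
  assumes "is_ring_hom \<phi>"
  shows "is_ring_hom (eval_poly \<phi> f)"
proof -
  have "eval_poly \<phi> f 1 = 1"
    using eval_poly_single[OF assms, of f 0 1]
    by (simp add: eval_monom_def is_ring_homD[OF assms])
  then show ?thesis
    by (simp add: is_ring_hom_def eval_poly_add[OF assms] eval_poly_mult[OF assms])
qed

lemma eval_poly_Const: "is_ring_hom \<phi> \<Longrightarrow> eval_poly \<phi> f (Const c) = \<phi> c"
  by (simp add: Const_def eval_poly_single eval_monom_def)

lemma eval_poly_Var: "is_ring_hom \<phi> \<Longrightarrow> eval_poly \<phi> f (Var s g) = f (s, g)"
  by (simp add: Var_def eval_poly_single eval_monom_def is_ring_homD)

definition respects_relations :: "(M2 \<Rightarrow> 'r) \<Rightarrow> ('s \<times> gen \<Rightarrow> 'r::comm_ring_1) \<Rightarrow> bool"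
  where "respects_relations \<phi> f \<longleftrightarrow>
    is_ring_hom \<phi> \<and> (\<forall>s i. f (s, Tau i) ^ 2 + \<phi> tau * f (s, Xi i) = 0)"

lemma eval_poly_relations:
  assumes "respects_relations \<phi> f" "p \<in> ideal_gen relations"
  shows "eval_poly \<phi> f p = 0"
proof -
  have \<phi>: "is_ring_hom \<phi>" using assms(1) by (simp add: respects_relations_def)
  note hom = is_ring_homD[OF eval_poly_is_ring_hom[OF \<phi>]]
  have "ideal_gen relations \<subseteq> {p. eval_poly \<phi> f p = 0}"
  proof (rule module.span_minimal[OF module_times])
    show "relations \<subseteq> {p. eval_poly \<phi> f p = 0}"
      using assms(1)
      by (auto simp: relations_def respects_relations_def hom eval_poly_Const eval_poly_Var)
    show "is_ideal {p. eval_poly \<phi> f p = 0}"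
      by (rule module.subspaceI[OF module_times]) (simp_all add: hom)
  qed
  then show ?thesis using assms(2) by auto
qed

lemma one_not_in_relations: "1 \<notin> ideal_gen relations"
proof
  assume "1 \<in> ideal_gen (relations :: 's free_alg set)"
  moreover have id: "is_ring_hom (\<lambda>x :: M2. x)" by (simp add: is_ring_hom_def)
  ultimately have "eval_poly (\<lambda>x. x) (\<lambda>_. 0) (1 :: 's free_alg) = 0"
    by (intro eval_poly_relations) (auto simp: respects_relations_def)
  then show False
    using is_ring_homD(1)[OF eval_poly_is_ring_hom[OF id], of "\<lambda>_ :: 's \<times> gen. 0"]
    by simp
qed

quotient_type 's steenrod =
  "'s free_alg" / "\<lambda>p q. p - q \<in> ideal_gen (relations :: 's free_alg set)"
  morphisms rep_steenrod abs_steenrod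
proof (rule equivpI)
  note span = module.span_zero[OF module_times] module.span_neg[OF module_times]
    module.span_add[OF module_times]
  show "reflp (\<lambda>p q. p - q \<in> ideal_gen (relations :: 's free_alg set))"
    by (simp add: reflp_def span)
  show "symp (\<lambda>p q. p - q \<in> ideal_gen (relations :: 's free_alg set))"
    by (metis (no_types, lifting) minus_diff_eq span(2) sympI)
  show "transp (\<lambda>p q. p - q \<in> ideal_gen (relations :: 's free_alg set))"
  proof (rule transpI)
    fix p q r :: "'s free_alg"
    assume "p - q \<in> ideal_gen relations" "q - r \<in> ideal_gen relations"
    from span(3)[OF this] show "p - r \<in> ideal_gen relations" by simp
  qed
qed

instantiation steenrod :: (type) comm_ring_1
begin

lift_definition zero_steenrod :: "'s steenrod" is 0 .

lift_definition one_steenrod :: "'s steenrod" is 1 .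

lift_definition plus_steenrod :: "'s steenrod \<Rightarrow> 's steenrod \<Rightarrow> 's steenrod" is "(+)"
  subgoal for p p' q q'
    using module.span_add[OF module_times, of "p - p'" relations "q - q'"]
    by (simp add: algebra_simps)
  done

lift_definition uminus_steenrod :: "'s steenrod \<Rightarrow> 's steenrod" is uminus
  subgoal for p p'
    using module.span_neg[OF module_times, of "p - p'" relations]
    by simp
  done

lift_definition minus_steenrod :: "'s steenrod \<Rightarrow> 's steenrod \<Rightarrow> 's steenrod" is "(-)"
  subgoal for p p' q q'
    using module.span_diff[OF module_times, of "p - p'" relations "q - q'"]
    by (simp add: algebra_simps)
  done

lift_definition times_steenrod :: "'s steenrod \<Rightarrow> 's steenrod \<Rightarrow> 's steenrod" is "(*)"
  subgoal for p p' q q'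
    using module.span_add[OF module_times, OF
        module.span_scale[OF module_times, of "p - p'" relations q]
        module.span_scale[OF module_times, of "q - q'" relations p']]
    by (simp add: algebra_simps)
  done

instance
proof
  show "(0 :: 's steenrod) \<noteq> 1"
    by transfer (use one_not_in_relations module.span_neg[OF module_times, of "- 1" relations]
      in \<open>auto\<close>)
qed (transfer, simp add: algebra_simps module.span_zero[OF module_times])+

end

lift_definition of_M2 :: "M2 \<Rightarrow> 's steenrod" is Const .

definition scale :: "M2 \<Rightarrow> 's steenrod \<Rightarrow> 's steenrod"
  where "scale c x = of_M2 c * x"

lift_definition generator :: "'s \<Rightarrow> gen \<Rightarrow> 's steenrod" is Var .

lemma of_M2_is_ring_hom: "is_ring_hom (of_M2 :: M2 \<Rightarrow> 's steenrod)"
proof -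
  have "of_M2 1 = (1 :: 's steenrod)" by transfer (simp add: Const_def module.span_zero[OF module_times])
  moreover have "of_M2 (x + y) = (of_M2 x + of_M2 y :: 's steenrod)" for x y
    by transfer (simp add: Const_def single_add module.span_zero[OF module_times])
  moreover have "of_M2 (x * y) = (of_M2 x * of_M2 y :: 's steenrod)" for x y
    by transfer (simp add: Const_def mult_single module.span_zero[OF module_times])
  ultimately show ?thesis by (simp add: is_ring_hom_def)
qed

lemma module_scale: "module (scale :: M2 \<Rightarrow> 's steenrod \<Rightarrow> 's steenrod)"
  by unfold_locales
     (simp_all add: scale_def is_ring_homD[OF of_M2_is_ring_hom] algebra_simps)

lemma generator_relation: "generator s (Tau i) ^ 2 + of_M2 tau * generator s (Xi i) = 0"
  unfolding power2_eq_square
  by transfer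
     (auto intro!: module.span_base[OF module_times] simp: relations_def simp flip: power2_eq_square)

text \<open>
  Extension of an assignment of values to the generators to a homomorphism of \<open>F\<^sub>2[\<tau>]\<close>-algebras.
  It does not depend on the chosen representative if the values respect the relations, as they
  do in all uses below (\<open>incl_respects\<close>, \<open>psi_respects\<close>, \<open>counit_respects\<close>, \<open>antipode_respects\<close>).
\<close>

definition hom_ext :: "(M2 \<Rightarrow> 'r) \<Rightarrow> ('s \<times> gen \<Rightarrow> 'r::comm_ring_1) \<Rightarrow> 's steenrod \<Rightarrow> 'r"
  where "hom_ext \<phi> f x = eval_poly \<phi> f (rep_steenrod x)"

lemma hom_ext_abs:
  assumes "respects_relations \<phi> f"
  shows "hom_ext \<phi> f (abs_steenrod p) = eval_poly \<phi> f p"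
proof -
  have \<phi>: "is_ring_hom \<phi>" using assms by (simp add: respects_relations_def)
  have "abs_steenrod (rep_steenrod (abs_steenrod p)) = abs_steenrod p"
    by (rule Quotient_abs_rep[OF Quotient_steenrod])
  then have "rep_steenrod (abs_steenrod p) - p \<in> ideal_gen relations"
    by (simp add: steenrod.abs_eq_iff)
  from eval_poly_relations[OF assms this] show ?thesis
    by (simp add: hom_ext_def is_ring_homD[OF eval_poly_is_ring_hom[OF \<phi>]])
qed

lemma
  assumes "respects_relations \<phi> f"
  shows hom_ext_is_ring_hom: "is_ring_hom (hom_ext \<phi> f)"
    and hom_ext_of_M2: "hom_ext \<phi> f (of_M2 c) = \<phi> c"
    and hom_ext_generator: "hom_ext \<phi> f (generator s g) = f (s, g)"
proof -
  note abs = hom_ext_abs[OF assms]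
  have \<phi>: "is_ring_hom \<phi>" using assms by (simp add: respects_relations_def)
  note hom = is_ring_homD[OF eval_poly_is_ring_hom[OF \<phi>]]
  have "hom_ext \<phi> f 1 = 1" by (simp add: one_steenrod.abs_eq abs hom)
  moreover have "hom_ext \<phi> f (x + y) = hom_ext \<phi> f x + hom_ext \<phi> f y" for x y
    by (induction x rule: steenrod.abs_induct, induction y rule: steenrod.abs_induct)
       (simp add: plus_steenrod.abs_eq abs hom)
  moreover have "hom_ext \<phi> f (x * y) = hom_ext \<phi> f x * hom_ext \<phi> f y" for x y
    by (induction x rule: steenrod.abs_induct, induction y rule: steenrod.abs_induct)
       (simp add: times_steenrod.abs_eq abs hom)
  ultimately show "is_ring_hom (hom_ext \<phi> f)" by (simp add: is_ring_hom_def)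
  show "hom_ext \<phi> f (of_M2 c) = \<phi> c"
    by (simp add: of_M2.abs_eq abs eval_poly_Const[OF \<phi>])
  show "hom_ext \<phi> f (generator s g) = f (s, g)"
    by (simp add: generator.abs_eq abs eval_poly_Var[OF \<phi>])
qed


subsection \<open>The Hopf algebra structure\<close>

type_synonym dual_steenrod = "unit steenrod"
type_synonym dual_steenrod2 = "bool steenrod"

definition taui :: "nat \<Rightarrow> dual_steenrod"
  where "taui i = generator () (Tau i)"

definition xi :: "nat \<Rightarrow> dual_steenrod"
  where "xi i = (case i of 0 \<Rightarrow> 1 | Suc j \<Rightarrow> generator () (Xi j))"

text \<open>The inclusions of the tensor factors; \<^const>\<open>False\<close> is the left one.\<close>

definition incl :: "'s \<Rightarrow> dual_steenrod \<Rightarrow> 's steenrod"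
  where "incl s = hom_ext of_M2 (\<lambda>(_, g). generator s g)"

definition tensor :: "dual_steenrod \<Rightarrow> dual_steenrod \<Rightarrow> dual_steenrod2"
  where "tensor x y = incl False x * incl True y"

fun psi_gen :: "gen \<Rightarrow> dual_steenrod2" where
  "psi_gen (Tau k) = tensor (taui k) 1 + (\<Sum>i\<le>k. tensor (xi (k - i) ^ 2 ^ i) (taui i))"
| "psi_gen (Xi k) = (\<Sum>i\<le>k + 1. tensor (xi (k + 1 - i) ^ 2 ^ i) (xi i))"

definition psi :: "dual_steenrod \<Rightarrow> dual_steenrod2"
  where "psi = hom_ext of_M2 (\<lambda>(_, g). psi_gen g)"

definition counit :: "dual_steenrod \<Rightarrow> M2"
  where "counit = hom_ext id (\<lambda>_. 0)"

text \<open>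
  The antipode is determined by the coproduct: \<open>id \<otimes> \<chi>\<close> followed by multiplication has to send
  \<open>\<psi>(\<xi>\<^sub>n)\<close> (for \<open>n \<ge> 1\<close>) and \<open>\<psi>(\<tau>\<^sub>n)\<close> to \<open>0\<close>. The recursions express this.
\<close>

function chi_xi :: "nat \<Rightarrow> dual_steenrod" where
  "chi_xi n = (if n = 0 then 1 else - (\<Sum>i<n. xi (n - i) ^ 2 ^ i * chi_xi i))"
  by auto
termination by (relation "measure id") auto

function chi_taui :: "nat \<Rightarrow> dual_steenrod" where
  "chi_taui n = - (taui n + (\<Sum>i<n. xi (n - i) ^ 2 ^ i * chi_taui i))"
  by auto
termination by (relation "measure id") auto

declare chi_xi.simps [simp del] chi_taui.simps [simp del]

fun chi_gen :: "gen \<Rightarrow> dual_steenrod" where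
  "chi_gen (Tau k) = chi_taui k"
| "chi_gen (Xi k) = chi_xi (k + 1)"

definition antipode :: "dual_steenrod \<Rightarrow> dual_steenrod"
  where "antipode = hom_ext of_M2 (\<lambda>(_, g). chi_gen g)"


lemma two_eq_0: "(2 :: 's steenrod) = 0"
proof -
  note hom = is_ring_homD[OF of_M2_is_ring_hom]
  have "(2 :: 's steenrod) = of_M2 1 + of_M2 1" by (simp add: hom)
  also have "\<dots> = of_M2 (1 + 1)" by (simp only: hom)
  also have "(1 :: M2) + 1 = 0" by (simp add: one_pCons)
  finally show ?thesis by (simp add: hom)
qed

lemma add_self: "(x :: 's steenrod) + x = 0"
  using two_eq_0 by (metis mult_2 mult_zero_left)

lemma uminus_steenrod_eq: "- (x :: 's steenrod) = x"
  using add_self[of x] by (simp add: add_eq_0_iff)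

lemma square_add: "((x :: 's steenrod) + y) ^ 2 = x ^ 2 + y ^ 2"
  by (simp add: power2_sum two_eq_0)

lemma square_sum: "(\<Sum>i\<in>S. f i :: 's steenrod) ^ 2 = (\<Sum>i\<in>S. f i ^ 2)"
  by (induction S rule: infinite_finite_induct) (simp_all add: square_add)

lemma generator_square: "generator s (Tau i) ^ 2 = of_M2 tau * generator s (Xi i)"
  using generator_relation[of s i] by (metis add_eq_0_iff uminus_steenrod_eq)

lemma taui_square: "taui i ^ 2 = of_M2 tau * xi (Suc i)"
  by (simp add: taui_def xi_def generator_square)

lemma incl_respects: "respects_relations of_M2 (\<lambda>(_, g). generator s g)"
  by (simp add: respects_relations_def of_M2_is_ring_hom generator_relation)

lemma incl_is_ring_hom: "is_ring_hom (incl s)"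
  unfolding incl_def by (rule hom_ext_is_ring_hom[OF incl_respects])

lemma incl_of_M2: "incl s (of_M2 c) = of_M2 c"
  by (simp add: incl_def hom_ext_of_M2[OF incl_respects])

lemma incl_taui: "incl s (taui i) = generator s (Tau i)"
  using hom_ext_generator[OF incl_respects] by (simp add: incl_def taui_def)

lemma incl_xi_Suc: "incl s (xi (Suc i)) = generator s (Xi i)"
  using hom_ext_generator[OF incl_respects] by (simp add: incl_def xi_def)

lemma incl_taui_square: "incl s (taui i) ^ 2 = of_M2 tau * incl s (xi (Suc i))"
  by (simp add: incl_taui incl_xi_Suc generator_square)

lemma psi_respects: "respects_relations of_M2 (\<lambda>(_, g). psi_gen g)"
proof -
  note hom = is_ring_homD[OF incl_is_ring_hom]
  have "psi_gen (Tau k) ^ 2 = of_M2 tau * psi_gen (Xi k)" for k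
  proof -
    have "psi_gen (Tau k) ^ 2 = of_M2 tau * incl False (xi (Suc k)) +
        (\<Sum>i\<le>k. incl False (xi (k - i)) ^ 2 ^ Suc i * (of_M2 tau * incl True (xi (Suc i))))"
      by (simp add: square_add square_sum tensor_def hom power_mult_distrib incl_taui_square
          power_mult[of _ 2 "2 ^ i" for i]) (simp add: power_commutes mult.commute flip: power_mult)
    also have "\<dots> = of_M2 tau * (incl False (xi (Suc k)) +
        (\<Sum>i\<le>k. incl False (xi (Suc k - Suc i)) ^ 2 ^ Suc i * incl True (xi (Suc i))))"
      by (simp add: algebra_simps sum_distrib_left)
    also have "\<dots> = of_M2 tau * psi_gen (Xi k)"
      unfolding psi_gen.simps Suc_eq_plus1[symmetric] sum.atMost_Suc_shift
      by (simp add: tensor_def hom xi_def[of 0])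
    finally show ?thesis .
  qed
  then show ?thesis
    by (simp add: respects_relations_def of_M2_is_ring_hom add_self del: psi_gen.simps)
qed

lemma psi_is_ring_hom: "is_ring_hom (psi)"
  unfolding psi_def by (rule hom_ext_is_ring_hom[OF psi_respects])

lemma psi_of_M2: "psi (of_M2 c) = of_M2 c"
  by (simp add: psi_def hom_ext_of_M2[OF psi_respects])

lemma psi_taui: "psi (taui k) = tensor (taui k) 1 + (\<Sum>i\<le>k. tensor (xi (k - i) ^ 2 ^ i) (taui i))"
  using hom_ext_generator[OF psi_respects, of "()" "Tau k"] by (simp add: psi_def taui_def)

lemma psi_xi: "psi (xi k) = (\<Sum>i\<le>k. tensor (xi (k - i) ^ 2 ^ i) (xi i))"
proof (cases k)
  case 0
  then show ?thesis
    by (simp add: xi_def tensor_def is_ring_homD(1)[OF psi_is_ring_hom]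
        is_ring_homD(1)[OF incl_is_ring_hom])
next
  case (Suc j)
  have "psi (xi (Suc j)) = psi_gen (Xi j)"
    using hom_ext_generator[OF psi_respects, of "()" "Xi j"] by (simp add: psi_def xi_def)
  then show ?thesis by (simp add: Suc)
qed

lemma counit_respects: "respects_relations id (\<lambda>_. 0)"
  by (simp add: respects_relations_def is_ring_hom_def)

lemma counit_is_ring_hom: "is_ring_hom (counit)"
  unfolding counit_def by (rule hom_ext_is_ring_hom[OF counit_respects])

lemma counit_of_M2: "counit (of_M2 c) = c"
  by (simp add: counit_def hom_ext_of_M2[OF counit_respects])

lemma counit_taui: "counit (taui i) = 0"
  using hom_ext_generator[OF counit_respects, of "()" "Tau i"] by (simp add: counit_def taui_def)

lemma counit_xi: "counit (xi (Suc i)) = 0"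
  using hom_ext_generator[OF counit_respects, of "()" "Xi i"] by (simp add: counit_def xi_def)

lemma chi_taui_square: "chi_taui n ^ 2 = of_M2 tau * chi_xi (Suc n)"
proof (induction n rule: less_induct)
  case (less n)
  have "chi_taui n ^ 2 = taui n ^ 2 + (\<Sum>i<n. (xi (n - i) ^ 2 ^ i) ^ 2 * chi_taui i ^ 2)"
    by (subst chi_taui.simps)
       (simp only: uminus_steenrod_eq square_add square_sum power_mult_distrib)
  also have "\<dots> = of_M2 tau * (xi (Suc n) +
      (\<Sum>i<n. xi (Suc n - Suc i) ^ 2 ^ Suc i * chi_xi (Suc i)))"
    by (simp add: less taui_square algebra_simps sum_distrib_left flip: power_mult)
  also have "\<dots> = of_M2 tau * chi_xi (Suc n)"
    unfolding chi_xi.simps[of "Suc n"] sum.lessThan_Suc_shift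
    by (simp add: uminus_steenrod_eq chi_xi.simps[of 0] del: diff_Suc_Suc)
  finally show ?case .
qed

lemma antipode_respects: "respects_relations of_M2 (\<lambda>(_, g). chi_gen g)"
  by (simp add: respects_relations_def of_M2_is_ring_hom chi_taui_square add_self)

lemma antipode_is_ring_hom: "is_ring_hom (antipode)"
  unfolding antipode_def by (rule hom_ext_is_ring_hom[OF antipode_respects])

lemma antipode_of_M2: "antipode (of_M2 c) = of_M2 c"
  by (simp add: antipode_def hom_ext_of_M2[OF antipode_respects])

lemma antipode_taui: "antipode (taui i) = chi_taui i"
  using hom_ext_generator[OF antipode_respects, of "()" "Tau i"] by (simp add: antipode_def taui_def)

lemma antipode_xi: "antipode (xi i) = chi_xi i"
proof (cases i)
  case 0
  then show ?thesis
    by (simp add: xi_def chi_xi.simps is_ring_homD(1)[OF antipode_is_ring_hom])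
next
  case (Suc j)
  then show ?thesis
    using hom_ext_generator[OF antipode_respects, of "()" "Xi j"] by (simp add: antipode_def xi_def Suc)
qed


subsection \<open>The bigrading and quotient Hopf algebras\<close>

fun gen_bideg :: "gen \<Rightarrow> int \<times> int" where
  "gen_bideg (Tau i) = (2 ^ (i + 1) - 1, 2 ^ i - 1)"
| "gen_bideg (Xi i) = (2 ^ (i + 2) - 2, 2 ^ (i + 1) - 1)"

text \<open>The bidegree of \<open>\<tau>\<^sup>n m\<close> for a monomial \<open>m\<close> in the generators; \<open>\<tau>\<close> has bidegree \<open>(0, -1)\<close>.\<close>

definition monom_bideg :: "nat \<Rightarrow> ((unit \<times> gen) \<Rightarrow>\<^sub>0 nat) \<Rightarrow> int \<times> int"
  where "monom_bideg n m =
    (\<Sum>v\<in>Poly_Mapping.keys m. int (Poly_Mapping.lookup m v) * fst (gen_bideg (snd v)),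
     (\<Sum>v\<in>Poly_Mapping.keys m. int (Poly_Mapping.lookup m v) * snd (gen_bideg (snd v))) - int n)"

definition homogeneous :: "int \<times> int \<Rightarrow> dual_steenrod \<Rightarrow> bool"
  where "homogeneous d x \<longleftrightarrow>
    (\<exists>p. x = abs_steenrod p \<and>
         (\<forall>m n. coeff (Poly_Mapping.lookup p m) n \<noteq> 0 \<longrightarrow> monom_bideg n m = d))"

definition bigraded_ideal :: "dual_steenrod set \<Rightarrow> bool"
  where "bigraded_ideal I \<longleftrightarrow> is_ideal I \<and> I = ideal_gen {x \<in> I. \<exists>d. homogeneous d x}"

text \<open>
  The quotient Hopf algebras are the quotients by bigraded Hopf ideals. The span in the second
  line is the image of \<open>I \<otimes> A \<oplus> A \<otimes> I\<close> in \<open>A \<otimes> A\<close>, that is, the kernel of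
  \<open>A \<otimes> A \<rightarrow> A/I \<otimes> A/I\<close>.
\<close>

definition hopf_ideal :: "dual_steenrod set \<Rightarrow> bool"
  where "hopf_ideal I \<longleftrightarrow> bigraded_ideal I \<and>
    psi ` I \<subseteq> module.span scale {tensor x y | x y. x \<in> I \<or> y \<in> I} \<and>
    counit ` I \<subseteq> {0} \<and>
    antipode ` I \<subseteq> I"


subsection \<open>Profile functions\<close>

text \<open>The value \<open>h 0\<close> plays no role.\<close>

definition profile_ideal :: "(nat \<Rightarrow> enat) \<Rightarrow> (nat \<Rightarrow> enat) \<Rightarrow> dual_steenrod set"
  where "profile_ideal h k = ideal_gen
    ({xi i ^ 2 ^ n | i n. i \<ge> 1 \<and> h i = enat n} \<union> {taui j ^ 2 ^ n | j n. k j = enat n})"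

definition free_profile :: "(nat \<Rightarrow> enat) \<Rightarrow> (nat \<Rightarrow> enat) \<Rightarrow> bool"
  where "free_profile h k \<longleftrightarrow>
    (\<forall>i. (k i \<noteq> 0 \<longrightarrow> h (i + 1) \<le> k i - 1) \<and> (k i = 0 \<longrightarrow> h (i + 1) = 0))"

end

theory Submission
  imports Defs
begin

text \<open>
  Sending \<open>\<tau>\<^sub>i\<close> to \<open>t x\<^sub>i\<close> and \<open>\<xi>\<^sub>i\<^sub>+\<^sub>1\<close> to \<open>t x\<^sub>i\<^sup>2\<close> embeds the dual motivic Steenrod algebra into the
  polynomial ring \<open>F\<^sub>2[t][x\<^sub>0, x\<^sub>1, \<dots>]\<close>, and a free quotient is torsion free, so an ideal with free
  quotient can be analysed by its coefficients there. The ideal of a free profile function becomes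
  the monomial ideal generated by powers \<open>x\<^sub>i ^ 2 ^ n\<close>, with \<open>n = 0\<close> if \<open>k i = 0\<close> and \<open>n = h (i + 1) + 1\<close>
  otherwise. Conversely, let \<open>h\<close> and \<open>k\<close> record which powers of the generators lie in a Hopf ideal
  \<open>I\<close>; it suffices to take \<open>k\<close> with values \<open>0\<close> and \<open>\<infinity>\<close>. An element of \<open>I\<close> of minimal degree outside
  the profile ideal would be primitive modulo this ideal, and the only such elements are multiples
  of powers \<open>x\<^sub>i ^ 2 ^ n\<close>. The two inequalities express that no term of the coproduct of a
  generator of the ideal survives in the tensor square of the quotient.
\<close>

abbreviation lookup :: "('k \<Rightarrow>\<^sub>0 'v::zero) \<Rightarrow> 'k \<Rightarrow> 'v"
  where "lookup \<equiv> Poly_Mapping.lookup"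

abbreviation keys :: "('k \<Rightarrow>\<^sub>0 'v::zero) \<Rightarrow> 'k set"
  where "keys \<equiv> Poly_Mapping.keys"

abbreviation single :: "'k \<Rightarrow> 'v \<Rightarrow> ('k \<Rightarrow>\<^sub>0 'v::zero)"
  where "single \<equiv> Poly_Mapping.single"

section \<open>Ideals and ring homomorphisms\<close>

interpretation ideal: module "(*) :: 'a::comm_ring_1 \<Rightarrow> 'a \<Rightarrow> 'a"
  by (rule module_times)

text \<open>As a rewrite rule this reverses \<open>mult.assoc\<close>, and loops with it.\<close>

declare ideal.scale_scale [simp del]

interpretation M2: module "scale :: M2 \<Rightarrow> 's steenrod \<Rightarrow> 's steenrod"
  by (rule module_scale)

lemma ideal_mult_left: "is_ideal I \<Longrightarrow> x \<in> I \<Longrightarrow> r * x \<in> I"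
  by (rule ideal.subspace_scale)

lemma ideal_mult_right: "is_ideal I \<Longrightarrow> x \<in> I \<Longrightarrow> x * r \<in> I"
  using ideal.subspace_scale[of I x r] by (simp add: mult.commute)

lemma ideal_power_mono:
  assumes "is_ideal I" "x ^ m \<in> I" "m \<le> n"
  shows "x ^ n \<in> I"
proof -
  have "x ^ n = x ^ m * x ^ (n - m)" using assms(3) by (simp flip: power_add)
  then show ?thesis using ideal_mult_right[OF assms(1,2)] by simp
qed

lemma ideal_scale: "is_ideal I \<Longrightarrow> x \<in> I \<Longrightarrow> scale c x \<in> I"
  unfolding scale_def by (rule ideal_mult_left)

lemma ideal_vimage:
  assumes "is_ring_hom \<phi>" "is_ideal I"
  shows "is_ideal {x. \<phi> x \<in> I}"
  by (rule ideal.subspaceI)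
     (use assms in \<open>simp_all add: is_ring_homD ideal.subspace_0 ideal.subspace_add ideal_mult_left\<close>)

lemma ring_hom_comp: "is_ring_hom f \<Longrightarrow> is_ring_hom g \<Longrightarrow> is_ring_hom (\<lambda>x. f (g x))"
  by (simp add: is_ring_hom_def)

lemma ring_hom_prod: "is_ring_hom \<phi> \<Longrightarrow> \<phi> (prod g S) = (\<Prod>i\<in>S. \<phi> (g i))"
  by (induction S rule: infinite_finite_induct) (simp_all add: is_ring_homD)


subsection \<open>Polynomials and monomial ideals\<close>

lemma Const_is_ring_hom: "is_ring_hom (Const :: M2 \<Rightarrow> 's free_alg)"
  by (simp add: is_ring_hom_def Const_def single_add mult_single flip: single_one)

lemma M2_add_self: "(c :: M2) + c = 0"
proof (rule poly_eqI)
  fix n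
  show "coeff (c + c) n = coeff 0 n"
    unfolding coeff_add by (cases "coeff c n") simp_all
qed

lemma free_alg_add_self: "(p :: 's free_alg) + p = 0"
  by (rule poly_mapping_eqI) (simp only: lookup_add M2_add_self lookup_zero)

lemma free_alg_two: "(2 :: 's free_alg) = 0"
  using free_alg_add_self[of 1] by simp

lemma tau_nonzero: "tau \<noteq> 0"
  by (simp add: tau_def)

lemma Var_power: "Var s g ^ n = single (single (s, g) n) 1"
  by (induction n) (simp_all add: Var_def mult_single flip: single_one single_add)

lemma Const_power: "Const c ^ n = Const (c ^ n)"
  by (simp add: is_ring_homD[OF Const_is_ring_hom])

lemma prod_single:
  "(\<Prod>v\<in>S. single (f v) (c v)) = single (\<Sum>v\<in>S. f v) (\<Prod>v\<in>S. c v)"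
  for c :: "'v \<Rightarrow> 'r::comm_semiring_1" and f :: "'v \<Rightarrow> 'm::comm_monoid_add"
  by (induction S rule: infinite_finite_induct) (simp_all add: mult_single)

lemma eval_monom_single: "eval_monom f (single v n) = f v ^ n"
  by (cases "n = 0") (simp_all add: eval_monom_def)

lemma lookup_single_mult:
  fixes p :: "('k \<Rightarrow>\<^sub>0 nat) \<Rightarrow>\<^sub>0 M2"
  shows "lookup (single 0 c * p) k = c * lookup p k"
proof -
  have "single 0 c * p =
      (\<Sum>m\<in>keys p. single m (c * lookup p m))"
    by (subst poly_mapping_sum_single[of p]) (simp add: sum_distrib_left mult_single)
  then show ?thesis
    by (auto simp: lookup_sum lookup_single when_def in_keys_iff sum.delta)
qed

lemma lookup_Const_mult: "lookup (Const c * p) k = c * lookup p k"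
  unfolding Const_def by (rule lookup_single_mult)

definition monomial_ideal :: "('v \<Rightarrow>\<^sub>0 nat) set \<Rightarrow> (('v \<Rightarrow>\<^sub>0 nat) \<Rightarrow>\<^sub>0 M2) set"
  where "monomial_ideal U = {p. keys p \<subseteq> U}"

definition up_closed :: "('v \<Rightarrow>\<^sub>0 nat) set \<Rightarrow> bool"
  where "up_closed U \<longleftrightarrow> (\<forall>e\<in>U. \<forall>f. e + f \<in> U)"

lemma monomial_ideal_is_ideal:
  assumes "up_closed U"
  shows "is_ideal (monomial_ideal U)"
proof (rule ideal.subspaceI)
  show "x + y \<in> monomial_ideal U" if "x \<in> monomial_ideal U" "y \<in> monomial_ideal U" for x y
    using that Poly_Mapping.keys_add[of x y] by (auto simp: monomial_ideal_def)
  show "c * x \<in> monomial_ideal U" if "x \<in> monomial_ideal U" for c x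
  proof -
    have "a + b \<in> U" if "b \<in> U" for a b
      using assms that by (simp add: up_closed_def add.commute[of a])
    then show ?thesis
      using that Poly_Mapping.keys_mult[of c x] by (fastforce simp: monomial_ideal_def)
  qed
qed (simp add: monomial_ideal_def)

lemma single_in_monomial_ideal: "e \<in> U \<Longrightarrow> single e c \<in> monomial_ideal U"
  by (auto simp: monomial_ideal_def)

lemma lookup_monomial_ideal: "p \<in> monomial_ideal U \<Longrightarrow> e \<notin> U \<Longrightarrow> lookup p e = 0"
  by (auto simp: monomial_ideal_def in_keys_iff)


subsection \<open>A basis, and an embedding into a polynomial ring\<close>

lemma free_alg_induct:
  fixes p :: "'s free_alg"
  assumes "\<And>c. P (Const c)" "\<And>s g. P (Var s g)"
    "\<And>p q. P p \<Longrightarrow> P q \<Longrightarrow> P (p + q)" "\<And>p q. P p \<Longrightarrow> P q \<Longrightarrow> P (p * q)"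
  shows "P p"
proof -
  have P1: "P 1" using assms(1)[of 1] by (simp add: is_ring_homD[OF Const_is_ring_hom])
  have P0: "P 0" using assms(1)[of 0] by (simp add: is_ring_homD[OF Const_is_ring_hom])
  have pow: "P (Var s g ^ n)" for s g n
    by (induction n) (auto intro: P1 assms)
  have "P (\<Prod>v\<in>S. single (single v (lookup m v)) 1)" for S m
    by (induction S rule: infinite_finite_induct)
       (use pow in \<open>auto intro!: P1 assms(4) simp flip: Var_power\<close>)
  from this[of m "keys m" for m] have mon: "P (single m 1)" for m
    unfolding prod_single prod.neutral_const poly_mapping_sum_single[symmetric] .
  have "P (Const c * single m 1)" for c m
    by (intro assms(1,4) mon)
  then have term_: "P (single m c)" for m c
    by (simp add: Const_def mult_single)
  have "P (\<Sum>m\<in>S. single m (lookup p m))" for S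
    by (induction S rule: infinite_finite_induct) (auto intro: P0 assms(3) term_)
  from this[of "keys p"] show ?thesis
    unfolding poly_mapping_sum_single[symmetric] .
qed

lemma steenrod_induct:
  fixes x :: "'s steenrod"
  assumes "\<And>c. P (of_M2 c)" "\<And>s g. P (generator s g)"
    "\<And>x y. P x \<Longrightarrow> P y \<Longrightarrow> P (x + y)" "\<And>x y. P x \<Longrightarrow> P y \<Longrightarrow> P (x * y)"
  shows "P x"
proof (induction x rule: steenrod.abs_induct)
  case (1 p)
  show ?case
  proof (induction p rule: free_alg_induct)
    case (1 c)
    show ?case using assms(1)[of c] unfolding of_M2.abs_eq .
  next
    case (2 s g)
    show ?case using assms(2)[of s g] unfolding generator.abs_eq .
  next
    case (3 p q)
    show ?case using assms(3)[OF 3] unfolding plus_steenrod.abs_eq .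
  next
    case (4 p q)
    show ?case using assms(4)[OF 4] unfolding times_steenrod.abs_eq .
  qed
qed

text \<open>Elements of the algebra are built from scalars and generators by sums and products, so
  stability under the generators alone makes an \<open>M2\<close>-span an ideal.\<close>

lemma span_is_ideal:
  assumes "\<And>s g x. x \<in> X \<Longrightarrow> generator s g * x \<in> M2.span X"
  shows "is_ideal (M2.span X)"
proof (rule ideal.subspaceI)
  show "r * z \<in> M2.span X" if "z \<in> M2.span X" for r z
    using that
  proof (induction r arbitrary: z rule: steenrod_induct)
    case (1 c)
    then show ?case unfolding scale_def[symmetric] by (rule M2.span_scale)
  next
    case (2 s g)
    have "M2.subspace {z. generator s g * z \<in> M2.span X}"
    proof (rule M2.subspaceI; unfold mem_Collect_eq)
      fix x y c
      show "generator s g * 0 \<in> M2.span X" by (simp add: M2.span_zero)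
      show "generator s g * (x + y) \<in> M2.span X"
        if "generator s g * x \<in> M2.span X" "generator s g * y \<in> M2.span X"
        using M2.span_add[OF that] by (simp add: distrib_left)
      show "generator s g * scale c x \<in> M2.span X" if "generator s g * x \<in> M2.span X"
        using M2.span_scale[OF that, of c] by (simp only: scale_def mult_ac)
    qed
    then have "M2.span X \<subseteq> {z. generator s g * z \<in> M2.span X}"
      by (intro M2.span_minimal) (use assms in auto)
    with 2 show ?case by blast
  next
    case (3 x y)
    show ?case unfolding distrib_right by (intro M2.span_add 3)
  next
    case (4 x y)
    show ?case unfolding mult.assoc by (intro 4)
  qed
qed (rule M2.span_zero, rule M2.span_add)

lemma steenrod_hom_eqI:
  assumes "is_ring_hom \<phi>" "is_ring_hom \<phi>'" "\<And>c. \<phi> (of_M2 c) = \<phi>' (of_M2 c)"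
    "\<And>s g. \<phi> (generator s g) = \<phi>' (generator s g)"
  shows "\<phi> x = \<phi>' x"
  by (induction x rule: steenrod_induct) (simp_all add: assms is_ring_homD[OF assms(1)] is_ring_homD[OF assms(2)])

text \<open>
  The polynomial ring is the subring of \<^typ>\<open>'s free_alg\<close> in the variables \<open>x\<^sub>i = Var s (Tau i)\<close>;
  the exponents of the other variables of \<^typ>\<open>'s free_alg\<close> are \<open>0\<close> throughout.
\<close>

fun to_poly_gen :: "'s \<times> gen \<Rightarrow> 's free_alg" where
  "to_poly_gen (s, Tau i) = Const tau * Var s (Tau i)"
| "to_poly_gen (s, Xi i) = Const tau * Var s (Tau i) ^ 2"

definition to_poly :: "'s steenrod \<Rightarrow> 's free_alg"
  where "to_poly = hom_ext Const to_poly_gen"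

lemma to_poly_respects: "respects_relations Const (to_poly_gen :: 's \<times> gen \<Rightarrow> 's free_alg)"
proof -
  have "(Const tau * x) ^ 2 + Const tau * (Const tau * x ^ 2) = 0" for x :: "'s free_alg"
    using free_alg_add_self[of "Const tau ^ 2 * x ^ 2"]
    by (simp only: power_mult_distrib power2_eq_square mult_ac)
  then show ?thesis by (simp add: respects_relations_def Const_is_ring_hom)
qed

lemma to_poly_is_ring_hom: "is_ring_hom to_poly"
  unfolding to_poly_def by (rule hom_ext_is_ring_hom[OF to_poly_respects])

lemma to_poly_of_M2: "to_poly (of_M2 c) = Const c"
  by (simp add: to_poly_def hom_ext_of_M2[OF to_poly_respects])

lemma to_poly_generator: "to_poly (generator s g) = to_poly_gen (s, g)"
  by (simp add: to_poly_def hom_ext_generator[OF to_poly_respects])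

lemma to_poly_scale: "to_poly (scale c x) = Const c * to_poly x"
  by (simp add: scale_def is_ring_homD[OF to_poly_is_ring_hom] to_poly_of_M2)

section \<open>A basis over the ground ring, indexed by the monomials in the
  \<open>x_i\<close>\<close>

definition tau_monom :: "(('s \<times> gen) \<Rightarrow>\<^sub>0 nat) \<Rightarrow> bool"
  where "tau_monom e \<longleftrightarrow> (\<forall>s i. lookup e (s, Xi i) = 0)"

lemma tau_monom_add: "tau_monom e \<Longrightarrow> tau_monom f \<Longrightarrow> tau_monom (e + f)"
  by (simp add: tau_monom_def lookup_add)

lemma tau_monom_single: "tau_monom (single (s, Tau i) n)"
  by (simp add: tau_monom_def lookup_single when_def)

lemma tau_monom_keys:
  assumes "tau_monom e" "v \<in> keys e"
  obtains s i where "v = (s, Tau i)"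
  using assms by (metis gen.exhaust in_keys_iff surj_pair tau_monom_def)

text \<open>Since \<open>to_poly\<close> sends \<open>generator s (Tau i)\<close> to
  \<open>tau * x_i\<close> and \<open>generator s (Xi i)\<close> to \<open>tau * x_i ^ 2\<close>,
  the exponents \<open>n mod 2\<close> and \<open>n div 2\<close> give a preimage of
  \<open>x_i ^ n\<close> up to a power of \<open>tau\<close>. The value at \<open>Xi i\<close> is a
  filler: an exponent with \<open>tau_monom\<close> has no such key.\<close>

fun basis_factor :: "'s \<times> gen \<Rightarrow> nat \<Rightarrow> 's steenrod" where
  "basis_factor (s, Tau i) n = generator s (Tau i) ^ (n mod 2) * generator s (Xi i) ^ (n div 2)"
| "basis_factor (s, Xi i) n = 1"

definition basis_elem :: "(('s \<times> gen) \<Rightarrow>\<^sub>0 nat) \<Rightarrow> 's steenrod"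
  where "basis_elem e = (\<Prod>v\<in>keys e. basis_factor v (lookup e v))"

text \<open>The power of \<open>tau\<close> by which the image of \<open>basis_elem e\<close>
  differs from the bare monomial \<open>e\<close>.\<close>

definition weight :: "(('s \<times> gen) \<Rightarrow>\<^sub>0 nat) \<Rightarrow> nat"
  where "weight e = (\<Sum>v\<in>keys e. lookup e v mod 2 + lookup e v div 2)"

lemma basis_factor_0: "basis_factor v 0 = 1"
  by (cases "(v, 0::nat)" rule: basis_factor.cases) simp_all

lemma to_poly_basis_factor:
  "to_poly (basis_factor (s, Tau i) n) =
    single (single (s, Tau i) n) (tau ^ (n mod 2 + n div 2))"
proof -
  let ?x = "Var s (Tau i)"
  have "to_poly (basis_factor (s, Tau i) n) =
      (Const tau * ?x) ^ (n mod 2) * (Const tau * ?x ^ 2) ^ (n div 2)"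
    by (simp only: basis_factor.simps is_ring_homD[OF to_poly_is_ring_hom] to_poly_generator
        to_poly_gen.simps)
  also have "\<dots> = Const tau ^ (n mod 2 + n div 2) * ?x ^ (n mod 2 + 2 * (n div 2))"
    by (simp only: power_mult_distrib power_add power_mult mult_ac)
  also have "\<dots> = single (single (s, Tau i) n) (tau ^ (n mod 2 + n div 2))"
    unfolding mod_mult_div_eq Var_power Const_power by (simp add: Const_def mult_single)
  finally show ?thesis .
qed

lemma to_poly_basis_elem:
  assumes "tau_monom e"
  shows "to_poly (basis_elem e) = single e (tau ^ weight e)"
proof -
  have "to_poly (basis_elem e) = (\<Prod>v\<in>keys e.
      single (single v (lookup e v)) (tau ^ (lookup e v mod 2 + lookup e v div 2)))"
    unfolding basis_elem_def ring_hom_prod[OF to_poly_is_ring_hom]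
    by (intro prod.cong refl) (metis assms tau_monom_keys to_poly_basis_factor)
  also have "\<dots> = single e (tau ^ weight e)"
    unfolding prod_single weight_def power_sum poly_mapping_sum_single[symmetric] ..
  finally show ?thesis .
qed

text \<open>The factor at \<open>v\<close> splits off even if \<open>v\<close> is not a key, because
  \<open>basis_factor v 0\<close> is 1.\<close>

lemma basis_elem_remove:
  "basis_elem e = basis_factor v (lookup e v) *
    (\<Prod>u\<in>keys e - {v}. basis_factor u (lookup e u))"
proof (cases "v \<in> keys e")
  case True
  then show ?thesis unfolding basis_elem_def by (rule prod.remove[OF finite_keys])
next
  case False
  then show ?thesis by (simp add: basis_elem_def in_keys_iff basis_factor_0)
qed

lemma basis_elem_add_single:
  "basis_elem (e + single v n) = basis_factor v (lookup e v + n) *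
    (\<Prod>u\<in>keys e - {v}. basis_factor u (lookup e u))"
proof -
  have other: "lookup (e + single v n) u = lookup e u" if "u \<noteq> v" for u
    using that by (simp add: lookup_add lookup_single)
  have "keys (e + single v n) - {v} = keys e - {v}"
    using other by (auto simp: in_keys_iff)
  moreover have "(\<Prod>u\<in>keys e - {v}. basis_factor u (lookup (e + single v n) u)) =
      (\<Prod>u\<in>keys e - {v}. basis_factor u (lookup e u))"
    by (rule prod.cong) (use other in auto)
  ultimately show ?thesis
    by (subst basis_elem_remove[of _ v]) (simp add: lookup_add)
qed

text \<open>For odd \<open>n\<close> two factors \<open>Tau i\<close> meet, and the defining
  relation turns them into \<open>tau\<close> times \<open>Xi i\<close>.\<close>

lemma Tau_mult_basis_factor:
  "generator s (Tau i) * basis_factor (s, Tau i) n =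
    scale (if even n then 1 else tau) (basis_factor (s, Tau i) (n + 1))"
proof (cases "even n")
  case False
  then obtain k where "n = 2 * k + 1" by (rule oddE)
  moreover have "generator s (Tau i) * (generator s (Tau i) * y) = of_M2 tau * (generator s (Xi i) * y)" for y
    using generator_square[of s i] by (simp only: power2_eq_square mult.assoc[symmetric])
  ultimately show ?thesis
    by (simp add: scale_def)
qed (auto elim!: evenE)

lemma Xi_mult_basis_factor:
  "generator s (Xi i) * basis_factor (s, Tau i) n = basis_factor (s, Tau i) (n + 2)"
  by (simp add: mult_ac)

text \<open>Multiplying a basis element by a generator raises one exponent by 1 or 2, up to a
  scalar. So the span is an ideal, and it contains 1.\<close>

lemma basis_elem_spans: "x \<in> M2.span (basis_elem ` {e. tau_monom e})"
proof -
  let ?S = "M2.span (basis_elem ` {e. tau_monom e}) :: 's steenrod set"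
  have gen: "generator s g * basis_elem e \<in> ?S" if "tau_monom e" for s g e
  proof (cases g)
    case (Tau i)
    have "generator s g * basis_elem e = scale (if even (lookup e (s, Tau i)) then 1 else tau)
        (basis_elem (e + single (s, Tau i) 1))"
      unfolding basis_elem_add_single Tau
      by (subst basis_elem_remove[of e "(s, Tau i)"])
         (simp only: Tau_mult_basis_factor mult.assoc[symmetric] scale_def)
    also have "\<dots> \<in> ?S"
      using that by (intro M2.span_scale M2.span_base imageI) (simp add: tau_monom_add tau_monom_single)
    finally show ?thesis .
  next
    case (Xi i)
    have "generator s g * basis_elem e = basis_elem (e + single (s, Tau i) 2)"
      unfolding basis_elem_add_single Xi
      by (subst basis_elem_remove[of e "(s, Tau i)"])
         (simp only: Xi_mult_basis_factor mult.assoc[symmetric])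
    also have "\<dots> \<in> ?S"
      using that by (intro M2.span_base imageI) (simp add: tau_monom_add tau_monom_single)
    finally show ?thesis .
  qed
  have S: "is_ideal ?S"
    by (rule span_is_ideal) (use gen in auto)
  have "1 \<in> ?S"
    by (rule M2.span_base, rule image_eqI[of _ _ 0]) (simp_all add: basis_elem_def tau_monom_def)
  from ideal_mult_left[OF S this, of x] show ?thesis by simp
qed

lemma basis_expansion:
  fixes x :: "'s steenrod"
  obtains F c where "finite F" "\<And>e. e \<in> F \<Longrightarrow> tau_monom e"
    "x = (\<Sum>e\<in>F. scale (c e) (basis_elem e))"
proof -
  obtain t r where t: "finite t" "t \<subseteq> basis_elem ` {e. tau_monom e}" "x = (\<Sum>a\<in>t. scale (r a) a)"
    using basis_elem_spans[of x] unfolding M2.span_explicit by blast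
  obtain F where F: "F \<subseteq> {e. tau_monom e}" "inj_on basis_elem F" "t = basis_elem ` F"
    using t(2) by (meson subset_image_inj)
  show thesis
  proof (rule that)
    show "finite F" using t(1) F by (simp add: finite_image_iff)
    show "tau_monom e" if "e \<in> F" for e using F that by blast
    show "x = (\<Sum>e\<in>F. scale (r (basis_elem e)) (basis_elem e))"
      using t(3) F by (simp add: sum.reindex)
  qed
qed

lemma to_poly_expansion:
  assumes "\<And>e. e \<in> F \<Longrightarrow> tau_monom e"
  shows "to_poly (\<Sum>e\<in>F. scale (c e) (basis_elem e)) = (\<Sum>e\<in>F. single e (c e * tau ^ weight e))"
  by (simp add: is_ring_homD[OF to_poly_is_ring_hom] to_poly_scale to_poly_basis_elem assms
      Const_def mult_single)

text \<open>Different exponents have different monomials as images, so no terms cancel and every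
  coefficient stays visible up to a power of \<open>tau\<close>. This is the source of linear
  independence.\<close>

lemma lookup_to_poly_expansion:
  assumes "finite F" "\<And>e. e \<in> F \<Longrightarrow> tau_monom e"
  shows "lookup (to_poly (\<Sum>e\<in>F. scale (c e) (basis_elem e))) e =
    (if e \<in> F then c e * tau ^ weight e else 0)"
  using assms by (simp add: to_poly_expansion lookup_sum lookup_single when_def sum.delta')

lemma inj_on_basis_elem: "inj_on basis_elem {e. tau_monom e}"
proof (rule inj_onI; unfold mem_Collect_eq)
  fix e f :: "('s \<times> gen) \<Rightarrow>\<^sub>0 nat"
  assume "tau_monom e" "tau_monom f" "basis_elem e = basis_elem f"
  then have "single e (tau ^ weight e) = single f (tau ^ weight f)"
    by (metis to_poly_basis_elem)
  from arg_cong[OF this, of keys] show "e = f" by (simp add: tau_nonzero)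
qed

lemma taui_generator: "taui i = generator () (Tau i)"
  by (simp add: taui_def)

lemma xi_generator: "xi (Suc i) = generator () (Xi i)"
  by (simp add: xi_def)

text \<open>The iterated Frobenius map in characteristic 2: the cross terms of a square are
  doubled.\<close>

lemma power_2_power_sum:
  fixes f :: "'i \<Rightarrow> 'a::comm_ring_1"
  assumes "(2 :: 'a) = 0"
  shows "(\<Sum>i\<in>S. f i) ^ 2 ^ n = (\<Sum>i\<in>S. f i ^ 2 ^ n)"
proof -
  have square: "(\<Sum>i\<in>S. g i) ^ 2 = (\<Sum>i\<in>S. g i ^ 2)" for g :: "'i \<Rightarrow> 'a"
    by (induction S rule: infinite_finite_induct) (simp_all add: power2_sum assms)
  show ?thesis
    by (induction n) (simp_all add: power_mult square mult.commute[of 2])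
qed

lemma power_2_power_add:
  fixes x y :: "'a::comm_ring_1"
  assumes "(2 :: 'a) = 0"
  shows "(x + y) ^ 2 ^ n = x ^ 2 ^ n + y ^ 2 ^ n"
  using power_2_power_sum[OF assms, of "\<lambda>b. if b then x else y" UNIV n] by (simp add: UNIV_bool add.commute)


subsection \<open>Ideals of free profile functions\<close>

text \<open>
  Up to powers of \<open>\<tau>\<close>, the generators \<open>\<tau>\<^sub>i\<close> and \<open>\<xi>\<^sub>i\<^sub>+\<^sub>1\<close> are \<open>x\<^sub>i\<close> and \<open>x\<^sub>i\<^sup>2\<close>; hence the ideal
  of a free profile function corresponds to the truncation of \<open>x\<^sub>i\<close> at height \<open>2 ^ height h k i\<close>.
\<close>

definition height :: "(nat \<Rightarrow> enat) \<Rightarrow> (nat \<Rightarrow> enat) \<Rightarrow> nat \<Rightarrow> enat"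
  where "height h k i = (if k i = 0 then 0 else eSuc (h (Suc i)))"

definition truncated :: "(nat \<Rightarrow> enat) \<Rightarrow> (('s \<times> gen) \<Rightarrow>\<^sub>0 nat) set"
  where "truncated \<kappa> = {e. \<exists>s i n. \<kappa> i = enat n \<and> 2 ^ n \<le> lookup e (s, Tau i)}"

lemma truncatedI: "\<kappa> i \<le> enat n \<Longrightarrow> 2 ^ n \<le> lookup e (s, Tau i) \<Longrightarrow> e \<in> truncated \<kappa>"
proof -
  assume "\<kappa> i \<le> enat n" "2 ^ n \<le> lookup e (s, Tau i)"
  moreover obtain m where "\<kappa> i = enat m" "m \<le> n"
    using \<open>\<kappa> i \<le> enat n\<close> by (cases "\<kappa> i") auto
  moreover have "(2::nat) ^ m \<le> 2 ^ n" using \<open>m \<le> n\<close> by simp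
  ultimately show ?thesis unfolding truncated_def by (blast intro: order_trans)
qed

lemma up_closed_truncated: "up_closed (truncated \<kappa>)"
  unfolding up_closed_def truncated_def by (fastforce simp: lookup_add intro: trans_le_add1)

lemma truncated_add:
  assumes "e + f \<notin> truncated \<kappa>"
  shows "e \<notin> truncated \<kappa>" "f \<notin> truncated \<kappa>"
  using assms up_closed_truncated[of \<kappa>] unfolding up_closed_def by (auto simp: add.commute)

lemma profile_ideal_is_ideal: "is_ideal (profile_ideal h k)"
  unfolding profile_ideal_def by (rule ideal.subspace_span)

lemma xi_in_profile_ideal:
  assumes "h i \<le> enat n" "i \<ge> 1"
  shows "xi i ^ 2 ^ n \<in> profile_ideal h k"
proof -
  obtain m where m: "h i = enat m" "m \<le> n"
    using assms(1) by (cases "h i") auto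
  then have "xi i ^ 2 ^ m \<in> profile_ideal h k"
    unfolding profile_ideal_def using assms(2) by (intro ideal.span_base) auto
  then show ?thesis
    by (rule ideal_power_mono[OF profile_ideal_is_ideal]) (simp add: m)
qed

lemma taui_in_profile_ideal:
  assumes "k j = 0"
  shows "taui j \<in> profile_ideal h k"
proof -
  have "taui j ^ 2 ^ 0 \<in> profile_ideal h k"
    unfolding profile_ideal_def by (intro ideal.span_base) (use assms in \<open>auto simp: zero_enat_def\<close>)
  then show ?thesis by simp
qed

lemma free_profileD:
  assumes "free_profile h k"
  shows "k i = 0 \<Longrightarrow> h (Suc i) = 0" "k i = enat (Suc n) \<Longrightarrow> h (Suc i) \<le> enat n"
  using assms by (auto simp: free_profile_def zero_enat_def one_enat_def dest!: spec[of _ i])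

text \<open>The other generators are \<open>taui j ^ 2 ^ Suc m\<close>. By the squaring relation
  such a power is a multiple of \<open>xi (Suc j) ^ 2 ^ m\<close>, and freeness gives
  \<open>h (Suc j) \<le> enat m\<close>.\<close>

lemma profile_ideal_least:
  assumes "free_profile h k" "is_ideal S"
    and xi: "\<And>i n. i \<ge> 1 \<Longrightarrow> h i = enat n \<Longrightarrow> xi i ^ 2 ^ n \<in> S"
    and taui: "\<And>j. k j = 0 \<Longrightarrow> taui j \<in> S"
  shows "profile_ideal h k \<subseteq> S"
  unfolding profile_ideal_def
proof (rule ideal.span_minimal[OF _ assms(2)]; safe)
  fix j n assume n: "k j = enat n"
  show "taui j ^ 2 ^ n \<in> S"
  proof (cases n)
    case 0
    then show ?thesis using taui[of j] n by (simp add: zero_enat_def)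
  next
    case (Suc m)
    obtain l where l: "h (Suc j) = enat l" "l \<le> m"
      using free_profileD(2)[OF assms(1), of j m] n Suc by (cases "h (Suc j)") auto
    have "xi (Suc j) ^ 2 ^ m \<in> S"
      using xi[OF _ l(1)] by (rule ideal_power_mono[OF assms(2)]) (use l in auto)
    moreover have "taui j ^ 2 ^ n = of_M2 tau ^ 2 ^ m * xi (Suc j) ^ 2 ^ m"
      using taui_square[of j] by (simp add: Suc power_mult power_mult_distrib)
    ultimately show ?thesis by (simp add: ideal_mult_left assms(2))
  qed
qed (use xi in auto)

text \<open>One factor, at an \<open>i\<close> with large exponent, already lies in the ideal:
  through \<open>taui i\<close> if the exponent is odd and \<open>k i = 0\<close>, and through the
  power of \<open>xi (Suc i)\<close> otherwise.\<close>

lemma basis_elem_in_profile_ideal: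
  assumes "free_profile h k" "e \<in> truncated (height h k)"
  shows "basis_elem e \<in> profile_ideal h k"
proof -
  note J = profile_ideal_is_ideal[of h k]
  obtain i n where n: "height h k i = enat n" "2 ^ n \<le> lookup e ((), Tau i)"
    using assms(2) by (auto simp: truncated_def)
  let ?r = "lookup e ((), Tau i)"
  have "basis_factor ((), Tau i) ?r \<in> profile_ideal h k"
  proof (cases "odd ?r \<and> k i = 0")
    case True
    then show ?thesis
      using taui_in_profile_ideal[of k i h] J
      by (auto simp: taui_generator odd_iff_mod_2_eq_one intro: ideal_mult_right)
  next
    case False
    obtain m where m: "h (Suc i) = enat m" "2 ^ m \<le> ?r div 2"
    proof (cases "k i = 0")
      case True
      \<comment> \<open>Here \<open>?r\<close> is even and at least \<open>2 ^ 0\<close>, hence at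
        least 2.\<close>
      have "1 \<le> ?r div 2" using True False n by (auto simp: height_def zero_enat_def elim!: evenE)
      then show thesis using that[of 0] True free_profileD(1)[OF assms(1)] by (simp add: zero_enat_def)
    next
      case False
      then obtain m where "h (Suc i) = enat m" "n = Suc m"
        using n(1) by (cases "h (Suc i)") (auto simp: height_def eSuc_enat)
      then show thesis using that n(2) by auto
    qed
    have "generator () (Xi i) ^ (?r div 2) \<in> profile_ideal h k"
      using xi_in_profile_ideal[of h "Suc i" m k] m
      by (intro ideal_power_mono[OF J _ m(2)]) (simp add: xi_generator)
    then show ?thesis using J by (simp add: ideal_mult_left)
  qed
  then show ?thesis
    unfolding basis_elem_remove[of e "((), Tau i)"] by (rule ideal_mult_right[OF J])
qed

lemma to_poly_xi: "to_poly (xi (Suc i)) = Const tau * Var () (Tau i) ^ 2"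
  by (simp add: xi_generator to_poly_generator)

lemma to_poly_taui: "to_poly (taui i) = Const tau * Var () (Tau i)"
  by (simp add: taui_generator to_poly_generator)

text \<open>From left to right this is checked on generators. Conversely, in the basis expansion of
  \<open>x\<close> the terms with truncated exponent lie in the profile ideal, and every other
  coefficient occurs in \<open>to_poly x\<close> times a power of \<open>tau\<close>, so it
  vanishes.\<close>

lemma in_profile_ideal_iff:
  assumes "free_profile h k"
  shows "x \<in> profile_ideal h k \<longleftrightarrow> to_poly x \<in> monomial_ideal (truncated (height h k))"
    (is "_ \<longleftrightarrow> _ \<in> ?N")
proof
  have N: "is_ideal ?N" by (rule monomial_ideal_is_ideal[OF up_closed_truncated])
  have Var: "Var () (Tau i) ^ 2 ^ n \<in> ?N" if "height h k i \<le> enat n" for i n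
    unfolding Var_power
    by (rule single_in_monomial_ideal, rule truncatedI[of _ i]) (use that in auto)
  have "profile_ideal h k \<subseteq> {x. to_poly x \<in> ?N}"
  proof (rule profile_ideal_least[OF assms ideal_vimage[OF to_poly_is_ring_hom N]]; unfold mem_Collect_eq)
    fix i n assume "(1::nat) \<le> i" "h i = enat n"
    moreover obtain j where "i = Suc j" using \<open>1 \<le> i\<close> by (cases i) auto
    \<comment> \<open>The image of \<open>xi (Suc j) ^ 2 ^ n\<close> is a scalar times
      \<open>x_j ^ 2 ^ Suc n\<close>; the height at \<open>j\<close> is at most
      \<open>Suc n\<close>, being 0 when \<open>k j = 0\<close>.\<close>
    ultimately have "Var () (Tau j) ^ 2 ^ Suc n \<in> ?N"
      by (intro Var) (auto simp: height_def eSuc_enat)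
    then show "to_poly (xi i ^ 2 ^ n) \<in> ?N"
      using \<open>i = Suc j\<close>
      by (simp add: is_ring_homD[OF to_poly_is_ring_hom] to_poly_xi power_mult_distrib
          ideal_mult_left[OF N] flip: power_mult)
  next
    fix j assume "k j = 0"
    then have "Var () (Tau j) \<in> ?N" using Var[of j 0] by (simp add: height_def)
    then show "to_poly (taui j) \<in> ?N" by (simp add: to_poly_taui ideal_mult_left[OF N])
  qed
  then show "x \<in> profile_ideal h k \<Longrightarrow> to_poly x \<in> ?N" by blast
next
  assume x: "to_poly x \<in> ?N"
  obtain F c where F: "finite F" "\<And>e. e \<in> F \<Longrightarrow> tau_monom e"
    "x = (\<Sum>e\<in>F. scale (c e) (basis_elem e))"
    using basis_expansion[of x] by blast
  have "scale (c e) (basis_elem e) \<in> profile_ideal h k" if "e \<in> F" for e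
  proof (cases "e \<in> truncated (height h k)")
    case True
    then show ?thesis
      by (intro ideal_scale profile_ideal_is_ideal basis_elem_in_profile_ideal assms)
  next
    case False
    have "c e * tau ^ weight e = 0"
      using lookup_monomial_ideal[OF x False] that F by (simp add: lookup_to_poly_expansion)
    then show ?thesis by (simp add: tau_nonzero ideal.subspace_0[OF profile_ideal_is_ideal])
  qed
  then show "x \<in> profile_ideal h k"
    unfolding F(3) by (rule ideal.subspace_sum[OF profile_ideal_is_ideal])
qed

text \<open>The basis elements whose exponent is not truncated represent a basis of the
  quotient.\<close>

lemma profile_ideal_free_quotient:
  assumes "free_profile h k"
  shows "free_quotient scale (profile_ideal h k)"
proof -
  let ?J = "profile_ideal h k" and ?U = "truncated (height h k)"
  let ?R = "{e :: (unit \<times> gen) \<Rightarrow>\<^sub>0 nat. tau_monom e \<and> e \<notin> ?U}"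
  have inj: "inj_on basis_elem ?R" by (rule inj_on_subset[OF inj_on_basis_elem]) auto
  show ?thesis
    unfolding free_quotient_def
  proof (rule exI[of _ "basis_elem ` ?R"], intro conjI allI impI)
    fix x :: dual_steenrod
    obtain F c where F: "finite F" "\<And>e. e \<in> F \<Longrightarrow> tau_monom e"
      "x = (\<Sum>e\<in>F. scale (c e) (basis_elem e))"
      using basis_expansion[of x] by blast
    \<comment> \<open>In \<open>free_quotient\<close> coefficients are indexed by elements, so those
      of the expansion are transported along an inverse of \<open>basis_elem\<close>.\<close>
    let ?c = "\<lambda>b. c (inv_into ?R basis_elem b)" and ?F = "F - ?U"
    have sub: "?F \<subseteq> ?R" using F(2) by auto
    have "(\<Sum>b\<in>basis_elem ` ?F. scale (?c b) b) = (\<Sum>e\<in>?F. scale (c e) (basis_elem e))"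
      using sub inv_into_f_f[OF inj]
      by (subst sum.reindex[OF inj_on_subset[OF inj sub]]) (auto intro!: sum.cong simp: F(2))
    then have "x - (\<Sum>b\<in>basis_elem ` ?F. scale (?c b) b) =
        (\<Sum>e\<in>F \<inter> ?U. scale (c e) (basis_elem e))"
      unfolding F(3) by (simp add: sum.Int_Diff[OF F(1), of _ ?U])
    also have "\<dots> \<in> ?J"
      by (rule ideal.subspace_sum[OF profile_ideal_is_ideal])
         (auto intro!: ideal_scale profile_ideal_is_ideal basis_elem_in_profile_ideal assms)
    finally show "\<exists>F c. finite F \<and> F \<subseteq> basis_elem ` ?R \<and> x - (\<Sum>b\<in>F. scale (c b) b) \<in> ?J"
      using F(1) sub by (intro exI[of _ "basis_elem ` ?F"] exI[of _ ?c]) blast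
  next
    fix F c
    assume F: "finite F \<and> F \<subseteq> basis_elem ` ?R \<and> (\<Sum>b\<in>F. scale (c b) b) \<in> ?J"
    then obtain G where G: "G \<subseteq> ?R" "F = basis_elem ` G" by (meson subset_imageE)
    have injG: "inj_on basis_elem G" using G inj by (blast intro: inj_on_subset)
    have fin: "finite G" using F G injG by (simp add: finite_image_iff)
    have "(\<Sum>e\<in>G. scale (c (basis_elem e)) (basis_elem e)) \<in> ?J"
      using F unfolding G(2) by (simp add: sum.reindex[OF injG])
    then have sum: "to_poly (\<Sum>e\<in>G. scale (c (basis_elem e)) (basis_elem e)) \<in> monomial_ideal ?U"
      by (simp add: in_profile_ideal_iff[OF assms])
    have "c (basis_elem e) = 0" if "e \<in> G" for e
    proof -
      have "e \<notin> ?U" "\<And>e. e \<in> G \<Longrightarrow> tau_monom e" using that G by auto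
      then show ?thesis
        using lookup_monomial_ideal[OF sum \<open>e \<notin> ?U\<close>] that fin
        by (simp add: lookup_to_poly_expansion tau_nonzero)
    qed
    then show "\<forall>b\<in>F. c b = 0" using G by auto
  qed
qed


subsection \<open>The Hopf ideal property\<close>

definition tensor_ideal :: "dual_steenrod set \<Rightarrow> dual_steenrod2 set"
  where "tensor_ideal I = M2.span {tensor x y | x y. x \<in> I \<or> y \<in> I}"

lemma tensor_mult: "tensor x y * tensor x' y' = tensor (x * x') (y * y')"
  by (simp add: tensor_def is_ring_homD[OF incl_is_ring_hom] mult_ac)

lemma tensor_power: "tensor x y ^ n = tensor (x ^ n) (y ^ n)"
  by (simp add: tensor_def is_ring_homD[OF incl_is_ring_hom] power_mult_distrib)

lemma generator_tensor:
  "generator s g = (if s then tensor 1 (generator () g) else tensor (generator () g) 1)"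
proof -
  have "incl s (generator () g) = generator s g"
    using hom_ext_generator[OF incl_respects, of s "()" g] by (simp add: incl_def)
  then show ?thesis by (auto simp: tensor_def is_ring_homD[OF incl_is_ring_hom])
qed

text \<open>Every generator of the tensor square is a pure tensor, so multiplication by it preserves
  the pure tensors with a factor in \<open>I\<close>.\<close>

lemma tensor_ideal_is_ideal:
  assumes "is_ideal I"
  shows "is_ideal (tensor_ideal I)"
  unfolding tensor_ideal_def
proof (rule span_is_ideal, rule M2.span_base, safe)
  fix s g x y
  assume "x \<in> I"
  then show "\<exists>x' y'. generator s g * tensor x y = tensor x' y' \<and> (x' \<in> I \<or> y' \<in> I)"
    using ideal_mult_left[OF assms] unfolding generator_tensor by (auto simp: tensor_mult)
next
  fix s g x y
  assume "y \<in> I"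
  then show "\<exists>x' y'. generator s g * tensor x y = tensor x' y' \<and> (x' \<in> I \<or> y' \<in> I)"
    using ideal_mult_left[OF assms] unfolding generator_tensor by (auto simp: tensor_mult)
qed

lemma psi_xi_power: "psi (xi i ^ 2 ^ n) = (\<Sum>a\<le>i. tensor (xi (i - a) ^ 2 ^ (a + n)) (xi a ^ 2 ^ n))"
  by (simp add: is_ring_homD[OF psi_is_ring_hom] psi_xi power_2_power_sum[OF two_eq_0] tensor_power
      power_add flip: power_mult)

lemma chi_xi_power:
  assumes "i \<ge> 1"
  shows "chi_xi i ^ 2 ^ n = (\<Sum>a<i. xi (i - a) ^ 2 ^ (a + n) * chi_xi a ^ 2 ^ n)"
  using assms by (subst chi_xi.simps)
    (simp add: uminus_steenrod_eq power_2_power_sum[OF two_eq_0] power_mult_distrib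
      power_add flip: power_mult)

lemma abs_steenrod_power: "abs_steenrod (p ^ n) = abs_steenrod p ^ n"
  by (induction n) (simp_all flip: one_steenrod.abs_eq times_steenrod.abs_eq)

lemma homogeneous_generator_power: "\<exists>d. homogeneous d (generator () g ^ n)"
proof (intro exI)
  let ?m = "single ((), g) n"
  have "generator () g ^ n = abs_steenrod (single ?m 1)"
    unfolding Var_power[symmetric] by (simp only: abs_steenrod_power generator.abs_eq)
  moreover have "monom_bideg i m = monom_bideg 0 ?m" if "coeff (lookup (single ?m (1 :: M2)) m) i \<noteq> 0" for m i
    using that by (auto simp: lookup_single when_def split: if_splits nat.splits)
  ultimately show "homogeneous (monom_bideg 0 ?m) (generator () g ^ n)"
    unfolding homogeneous_def by blast
qed

text \<open>Preimages of ideals under ring homomorphisms are ideals, so by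
  \<open>profile_ideal_least\<close> each clause of \<open>hopf_ideal\<close> need only be checked
  on \<open>xi i ^ 2 ^ n\<close> with \<open>h i = enat n\<close> and on \<open>taui j\<close> with
  \<open>k j = 0\<close>.\<close>

lemma profile_ideal_hopf_ideal:
  assumes free: "free_profile h k"
    and h: "\<And>i j. i \<ge> 1 \<Longrightarrow> j \<ge> 1 \<Longrightarrow> h i \<le> enat j + h (i + j) \<or> h j \<le> h (i + j)"
    and k: "\<And>i j. i \<ge> 1 \<Longrightarrow> h i \<le> enat j + k (i + j) \<or> k j \<le> k (i + j)"
  shows "hopf_ideal (profile_ideal h k)"
proof -
  let ?J = "profile_ideal h k"
  note J = profile_ideal_is_ideal[of h k] and K = tensor_ideal_is_ideal[OF profile_ideal_is_ideal[of h k]]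
  note least = profile_ideal_least[OF free]
  have tensor1: "tensor x y \<in> tensor_ideal ?J" if "x \<in> ?J" for x y
    unfolding tensor_ideal_def by (rule M2.span_base) (use that in blast)
  have tensor2: "tensor x y \<in> tensor_ideal ?J" if "y \<in> ?J" for x y
    unfolding tensor_ideal_def by (rule M2.span_base) (use that in blast)
  \<comment> \<open>The inequality for the pair \<open>i - a\<close>, \<open>a\<close>: in the term
    \<open>a\<close> of the coproduct of \<open>xi i ^ 2 ^ n\<close>, the left or the right factor
    lies in \<open>?J\<close>.\<close>
  have split_h: "h (i - a) \<le> enat (a + n) \<or> h a \<le> enat n" if "h i \<le> enat n" "1 \<le> a" "a < i" for i a n
  proof -
    have "enat a + h i \<le> enat (a + n)" using add_left_mono[OF that(1), of "enat a"] by simp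
    moreover have "h (i - a) \<le> enat a + h i \<or> h a \<le> h i" using h[of "i - a" a] that by simp
    ultimately show ?thesis using that(1) order_trans by blast
  qed
  \<comment> \<open>The same for the coproduct of \<open>taui j\<close>; as \<open>k j = 0\<close>,
    the second alternative forces \<open>k a = 0\<close>.\<close>
  have split_k: "h (j - a) \<le> enat a \<or> k a = 0" if "k j = 0" "a < j" for j a
    using k[of "j - a" a] that by simp

  have "?J = ideal_gen {x \<in> ?J. \<exists>d. homogeneous d x}"
  proof
    show "ideal_gen {x \<in> ?J. \<exists>d. homogeneous d x} \<subseteq> ?J"
      by (rule ideal.span_minimal[OF _ J]) auto
    show "?J \<subseteq> ideal_gen {x \<in> ?J. \<exists>d. homogeneous d x}"
    proof (rule least[OF ideal.subspace_span]; rule ideal.span_base)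
      fix i n assume "(1::nat) \<le> i" "h i = enat n"
      then show "xi i ^ 2 ^ n \<in> {x \<in> ?J. \<exists>d. homogeneous d x}"
        using xi_in_profile_ideal[of h i n k] homogeneous_generator_power[of _ "2 ^ n"]
        by (cases i) (auto simp: xi_generator)
    next
      fix j assume "k j = 0"
      then show "taui j \<in> {x \<in> ?J. \<exists>d. homogeneous d x}"
        using taui_in_profile_ideal[of k j h] homogeneous_generator_power[of "Tau j" 1]
        by (simp add: taui_generator)
    qed
  qed
  moreover have "?J \<subseteq> {x. psi x \<in> tensor_ideal ?J}"
  proof (rule least[OF ideal_vimage[OF psi_is_ring_hom K]]; unfold mem_Collect_eq)
    fix i n assume i: "(1::nat) \<le> i" "h i = enat n"
    have "tensor (xi (i - a) ^ 2 ^ (a + n)) (xi a ^ 2 ^ n) \<in> tensor_ideal ?J" if "a \<le> i" for a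
    proof -
      consider "a = 0" | "a = i" | "1 \<le> a" "a < i" using \<open>a \<le> i\<close> by linarith
      then show ?thesis
      proof cases
        case 1
        then show ?thesis using i by (intro tensor1 xi_in_profile_ideal) auto
      next
        case 2
        then show ?thesis using i by (intro tensor2 xi_in_profile_ideal) auto
      next
        case 3
        then show ?thesis
          using split_h[of i n a] i
          by (auto intro: tensor1[OF xi_in_profile_ideal] intro: tensor2[OF xi_in_profile_ideal])
      qed
    qed
    then show "psi (xi i ^ 2 ^ n) \<in> tensor_ideal ?J"
      unfolding psi_xi_power by (intro ideal.subspace_sum[OF K]) auto
  next
    fix j assume j: "k j = 0"
    have "tensor (xi (j - a) ^ 2 ^ a) (taui a) \<in> tensor_ideal ?J" if "a \<le> j" for a
    proof (cases "a = j")
      case True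
      then show ?thesis using j by (intro tensor2 taui_in_profile_ideal) auto
    next
      case False
      then have "a < j" using that by simp
      from split_k[OF j this] show ?thesis
        using \<open>a < j\<close> by (auto intro: tensor1[OF xi_in_profile_ideal] tensor2[OF taui_in_profile_ideal])
    qed
    then have "(\<Sum>a\<le>j. tensor (xi (j - a) ^ 2 ^ a) (taui a)) \<in> tensor_ideal ?J"
      by (intro ideal.subspace_sum[OF K]) simp
    then show "psi (taui j) \<in> tensor_ideal ?J"
      unfolding psi_taui using j by (intro ideal.subspace_add[OF K] tensor1 taui_in_profile_ideal)
  qed
  moreover have "?J \<subseteq> {x. counit x \<in> {0}}"
  proof (rule least[OF ideal_vimage[OF counit_is_ring_hom ideal.subspace_single_0]];
      unfold mem_Collect_eq)
    fix i n assume "(1::nat) \<le> i"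
    then show "counit (xi i ^ 2 ^ n) \<in> {0}"
      by (cases i) (simp_all add: is_ring_homD[OF counit_is_ring_hom] counit_xi)
  qed (simp add: counit_taui)
  moreover have "?J \<subseteq> {x. antipode x \<in> ?J}"
  proof (rule least[OF ideal_vimage[OF antipode_is_ring_hom J]]; unfold mem_Collect_eq)
    \<comment> \<open>In each term of the recursion for \<open>chi_xi\<close>, the left factor lies
      in \<open>?J\<close> by the same dichotomy or the right one does by induction.\<close>
    have chi: "chi_xi i ^ 2 ^ n \<in> ?J" if "1 \<le> i" "h i \<le> enat n" for i n
      using that
    proof (induction i rule: less_induct)
      case (less i)
      have "xi (i - a) ^ 2 ^ (a + n) * chi_xi a ^ 2 ^ n \<in> ?J" if "a < i" for a
      proof (cases "h (i - a) \<le> enat (a + n)")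
        case True
        then show ?thesis using \<open>a < i\<close> by (intro ideal_mult_right[OF J] xi_in_profile_ideal) auto
      next
        case False
        \<comment> \<open>For \<open>a = 0\<close> the left factor is \<open>xi i ^ 2 ^ n\<close>
          itself.\<close>
        then have "1 \<le> a" using less.prems by (cases a) auto
        then show ?thesis
          using less.IH[of a] split_h[of i n a] False \<open>a < i\<close> less.prems
          by (intro ideal_mult_left[OF J]) auto
      qed
      then show ?case unfolding chi_xi_power[OF less.prems(1)] by (intro ideal.subspace_sum[OF J]) auto
    qed
    fix i n assume "(1::nat) \<le> i" "h i = enat n"
    then show "antipode (xi i ^ 2 ^ n) \<in> ?J"
      using chi[of i n] by (simp add: is_ring_homD[OF antipode_is_ring_hom] antipode_xi)
  next
    fix j assume "k j = 0"
    then have "chi_taui j \<in> ?J"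
    proof (induction j rule: less_induct)
      case (less j)
      have "xi (j - a) ^ 2 ^ a * chi_taui a \<in> ?J" if "a < j" for a
        using split_k[OF less.prems that]
      proof
        assume "h (j - a) \<le> enat a"
        then show ?thesis using that by (intro ideal_mult_right[OF J] xi_in_profile_ideal) auto
      next
        assume "k a = 0"
        then show ?thesis using less.IH that by (intro ideal_mult_left[OF J]) auto
      qed
      then have "(\<Sum>a<j. xi (j - a) ^ 2 ^ a * chi_taui a) \<in> ?J"
        by (intro ideal.subspace_sum[OF J]) simp
      then show ?case
        unfolding chi_taui.simps[of j] using less.prems
        by (intro ideal.subspace_neg[OF J] ideal.subspace_add[OF J] taui_in_profile_ideal)
    qed
    then show "antipode (taui j) \<in> ?J" by (simp add: antipode_taui)
  qed
  ultimately show ?thesis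
    unfolding hopf_ideal_def bigraded_ideal_def tensor_ideal_def using J by blast
qed

subsection \<open>The coproduct on the polynomial ring\<close>

definition rename :: "'s \<Rightarrow> ((unit \<times> gen) \<Rightarrow>\<^sub>0 nat) \<Rightarrow> (('s \<times> gen) \<Rightarrow>\<^sub>0 nat)"
  where "rename s e = (\<Sum>v\<in>keys e. single (s, snd v) (lookup e v))"

lemma lookup_rename: "lookup (rename s e) (s', g) = (if s' = s then lookup e ((), g) else 0)"
proof -
  have "lookup (rename s e) (s', g) = (\<Sum>v\<in>keys e. if v = ((), g) then (if s' = s then lookup e v else 0) else 0)"
    unfolding rename_def lookup_sum
    by (intro sum.cong refl) (auto simp: lookup_single when_def)
  also have "\<dots> = (if s' = s then lookup e ((), g) else 0)"
    by (simp add: in_keys_iff)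
  finally show ?thesis .
qed

lemma rename_single: "rename s (single ((), g) n) = single (s, g) n"
  by (rule poly_mapping_eqI) (auto simp: lookup_rename lookup_single when_def split_paired_all)

lemma rename_eq_iff: "rename s e = rename s f \<longleftrightarrow> e = f"
proof
  assume eq: "rename s e = rename s f"
  have "lookup e ((), g) = lookup f ((), g)" for g
    using arg_cong[OF eq, of "\<lambda>k. lookup k (s, g)"] by (simp add: lookup_rename)
  then show "e = f" by (auto intro!: poly_mapping_eqI)
qed simp

lemma rename_add_eq_iff:
  "rename False e + rename True f = rename False e' + rename True f' \<longleftrightarrow> e = e' \<and> f = f'"
proof
  assume eq: "rename False e + rename True f = rename False e' + rename True f'"
  have "lookup e ((), g) = lookup e' ((), g)" "lookup f ((), g) = lookup f' ((), g)" for g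
    using arg_cong[OF eq, of "\<lambda>k. lookup k (False, g)"] arg_cong[OF eq, of "\<lambda>k. lookup k (True, g)"]
    by (simp_all add: lookup_add lookup_rename)
  then show "e = e' \<and> f = f'" by (auto intro!: poly_mapping_eqI)
qed simp

definition incl_poly :: "'s \<Rightarrow> unit free_alg \<Rightarrow> 's free_alg"
  where "incl_poly s = eval_poly Const (\<lambda>(_, g). Var s g)"

lemma eval_monom_rename: "eval_monom (\<lambda>(_, g). Var s g) e = single (rename s e) 1"
  by (simp add: eval_monom_def case_prod_beta Var_power prod_single rename_def)

lemma incl_poly_is_ring_hom: "is_ring_hom (incl_poly s)"
  unfolding incl_poly_def by (rule eval_poly_is_ring_hom[OF Const_is_ring_hom])

lemma incl_poly_single: "incl_poly s (single e c) = single (rename s e) c"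
  by (simp add: incl_poly_def eval_poly_single[OF Const_is_ring_hom] eval_monom_rename Const_def mult_single)

lemma incl_poly_Const: "incl_poly s (Const c) = Const c"
  by (simp add: incl_poly_def eval_poly_Const[OF Const_is_ring_hom])

lemma incl_poly_Var: "incl_poly s (Var () g) = Var s g"
  by (simp add: incl_poly_def eval_poly_Var[OF Const_is_ring_hom])

lemma incl_generator: "incl s (generator t g) = generator s g"
  using hom_ext_generator[OF incl_respects, of s t g] by (simp add: incl_def)

lemma to_poly_incl: "to_poly (incl s x) = incl_poly s (to_poly x)"
proof (rule steenrod_hom_eqI)
  show "is_ring_hom (\<lambda>x. to_poly (incl s x))" "is_ring_hom (\<lambda>x. incl_poly s (to_poly x))"
    by (rule ring_hom_comp[OF to_poly_is_ring_hom incl_is_ring_hom],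
        rule ring_hom_comp[OF incl_poly_is_ring_hom to_poly_is_ring_hom])
  show "to_poly (incl s (generator t g)) = incl_poly s (to_poly (generator t g))" for t g
    unfolding incl_generator to_poly_generator
    by (cases g) (simp_all add: is_ring_homD[OF incl_poly_is_ring_hom] incl_poly_Const incl_poly_Var)
qed (simp add: incl_of_M2 to_poly_of_M2 incl_poly_Const)

lemma to_poly_tensor: "to_poly (tensor x y) = incl_poly False (to_poly x) * incl_poly True (to_poly y)"
  by (simp add: tensor_def is_ring_homD[OF to_poly_is_ring_hom] to_poly_incl)

text \<open>Monomials in the two copies of the variables are independent, so at most one pair of
  terms contributes.\<close>

lemma lookup_incl_poly_mult:
  "lookup (incl_poly False p * incl_poly True q) (rename False e + rename True f) = lookup p e * lookup q f"
proof -
  have "incl_poly False p * incl_poly True q =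
      incl_poly False (\<Sum>a\<in>keys p. single a (lookup p a)) * incl_poly True (\<Sum>b\<in>keys q. single b (lookup q b))"
    unfolding poly_mapping_sum_single[symmetric] ..
  also have "\<dots> = (\<Sum>a\<in>keys p. \<Sum>b\<in>keys q.
      single (rename False a + rename True b) (lookup p a * lookup q b))"
    by (simp add: is_ring_homD[OF incl_poly_is_ring_hom] incl_poly_single sum_product mult_single)
  finally have "lookup (incl_poly False p * incl_poly True q) (rename False e + rename True f) =
      (\<Sum>a\<in>keys p. \<Sum>b\<in>keys q. if b = f then (if a = e then lookup p a * lookup q b else 0) else 0)"
    by (auto simp: lookup_sum lookup_single when_def rename_add_eq_iff intro!: sum.cong)
  then show ?thesis by (cases "lookup q f = 0") (simp_all add: in_keys_iff)
qed

lemma lookup_to_poly_tensor: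
  "lookup (to_poly (tensor x y)) (rename False e + rename True f) =
    lookup (to_poly x) e * lookup (to_poly y) f"
  by (simp add: to_poly_tensor lookup_incl_poly_mult)

text \<open>The coefficient of a tensor is the product of the coefficients of its factors, and it
  vanishes if a factor is in \<open>I\<close>; linearity extends this to the span. It constrains the
  coproducts of elements of \<open>I\<close>.\<close>

lemma lookup_tensor_ideal:
  assumes "z \<in> tensor_ideal I"
    and "\<And>x. x \<in> I \<Longrightarrow> lookup (to_poly x) e = 0" "\<And>x. x \<in> I \<Longrightarrow> lookup (to_poly x) f = 0"
  shows "lookup (to_poly z) (rename False e + rename True f) = 0"
proof -
  let ?k = "rename False e + rename True f"
  have "tensor_ideal I \<subseteq> {z. lookup (to_poly z) ?k = 0}"
    unfolding tensor_ideal_def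
  proof (rule M2.span_minimal)
    show "M2.subspace {z. lookup (to_poly z) ?k = 0}"
      by (rule M2.subspaceI)
         (simp_all add: is_ring_homD[OF to_poly_is_ring_hom] to_poly_scale lookup_add lookup_Const_mult)
  qed (use assms in \<open>auto simp: lookup_to_poly_tensor\<close>)
  then show ?thesis using assms(1) by blast
qed

text \<open>In the coordinates \<open>x_i\<close>, the element \<open>xi (k - i) ^ 2 ^ i\<close>
  with \<open>i < k\<close> becomes \<open>tau ^ 2 ^ i\<close> times the power
  \<open>2 ^ Suc i\<close> of the variable with index \<open>k - Suc i\<close>; the term
  \<open>i = k\<close> of the coproduct is the summand \<open>Var True (Tau k)\<close>. The
  variables \<open>Xi k\<close> lie outside the subring, and their value is a filler that keeps
  later congruences uniform.\<close>

fun diagonal_gen :: "unit \<times> gen \<Rightarrow> bool free_alg" where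
  "diagonal_gen (_, Tau k) = Var False (Tau k) + Var True (Tau k) +
    (\<Sum>i<k. Const (tau ^ 2 ^ i) * Var False (Tau (k - Suc i)) ^ 2 ^ Suc i * Var True (Tau i))"
| "diagonal_gen (_, Xi k) = Var True (Xi k)"

text \<open>Dividing the coproduct of \<open>\<tau>\<^sub>k = t x\<^sub>k\<close> by \<open>t\<close> extends it to the polynomial ring.\<close>

definition diagonal :: "unit free_alg \<Rightarrow> bool free_alg"
  where "diagonal = eval_poly Const diagonal_gen"

lemma diagonal_is_ring_hom: "is_ring_hom diagonal"
  unfolding diagonal_def by (rule eval_poly_is_ring_hom[OF Const_is_ring_hom])

lemma diagonal_Const: "diagonal (Const c) = Const c"
  by (simp add: diagonal_def eval_poly_Const[OF Const_is_ring_hom])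

lemma diagonal_Var: "diagonal (Var () g) = diagonal_gen ((), g)"
  by (simp add: diagonal_def eval_poly_Var[OF Const_is_ring_hom])

lemma xi_0: "xi 0 = 1"
  by (simp add: xi_def)

lemma to_poly_psi_gen_Tau: "to_poly (psi_gen (Tau k)) = Const tau * diagonal_gen ((), Tau k)"
proof -
  note hom = is_ring_homD[OF to_poly_is_ring_hom] is_ring_homD[OF incl_poly_is_ring_hom]
  have "to_poly (tensor (xi (k - i) ^ 2 ^ i) (taui i)) = Const tau *
      (Const (tau ^ 2 ^ i) * Var False (Tau (k - Suc i)) ^ 2 ^ Suc i * Var True (Tau i))" if "i < k" for i
  proof -
    have "k - i = Suc (k - Suc i)" using that by simp
    then show ?thesis
      by (simp only: to_poly_tensor hom to_poly_xi to_poly_taui incl_poly_Const incl_poly_Var)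
         (simp add: power_mult_distrib Const_power mult_ac flip: power_mult)
  qed
  then show ?thesis
    by (simp add: lessThan_Suc_atMost[symmetric] hom to_poly_tensor[of "taui k"] to_poly_tensor[of 1]
        xi_0 to_poly_taui incl_poly_Const incl_poly_Var sum_distrib_left algebra_simps)
qed

lemma Const_mult_cancel: "c \<noteq> 0 \<Longrightarrow> Const c * p = Const c * q \<Longrightarrow> p = q"
  by (rule poly_mapping_eqI) (metis lookup_Const_mult mult_left_cancel)

lemma to_poly_psi: "to_poly (psi x) = diagonal (to_poly x)"
proof (rule steenrod_hom_eqI)
  show "is_ring_hom (\<lambda>x. to_poly (psi x))" "is_ring_hom (\<lambda>x. diagonal (to_poly x))"
    by (rule ring_hom_comp[OF to_poly_is_ring_hom psi_is_ring_hom],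
        rule ring_hom_comp[OF diagonal_is_ring_hom to_poly_is_ring_hom])
  note hom = is_ring_homD[OF to_poly_is_ring_hom] is_ring_homD[OF diagonal_is_ring_hom]
  show "to_poly (psi (generator t g)) = diagonal (to_poly (generator t g))" for t g
  proof -
    have psi: "psi (generator t g) = psi_gen g" for t g
      using hom_ext_generator[OF psi_respects, of t g] by (simp add: psi_def)
    show ?thesis
    proof (cases g)
      case (Tau k)
      then show ?thesis
        unfolding psi Tau to_poly_psi_gen_Tau
        by (simp add: to_poly_generator hom diagonal_Const diagonal_Var del: diagonal_gen.simps)
    next
      case (Xi k)
      \<comment> \<open>The value on \<open>Xi k\<close> follows from the one on
        \<open>Tau k\<close> by squaring and cancelling \<open>tau\<close>.\<close>
      have "psi_gen (Tau k) ^ 2 = of_M2 tau * psi_gen (Xi k)"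
        using psi_respects by (simp add: respects_relations_def add_eq_0_iff uminus_steenrod_eq)
      from arg_cong[OF this, of to_poly]
      have "Const tau * to_poly (psi_gen (Xi k)) = Const tau * (Const tau * diagonal_gen ((), Tau k) ^ 2)"
        unfolding hom to_poly_psi_gen_Tau to_poly_of_M2 by (simp only: power2_eq_square mult_ac)
      from Const_mult_cancel[OF tau_nonzero this] show ?thesis
        unfolding psi Xi
        by (simp add: to_poly_generator hom diagonal_Const diagonal_Var del: diagonal_gen.simps)
    qed
  qed
qed (simp add: psi_of_M2 to_poly_of_M2 diagonal_Const)


subsection \<open>Coefficients of the coproduct\<close>

lemma ideal_diff_mult:
  assumes "is_ideal I" "p - p' \<in> I" "q - q' \<in> I"
  shows "p * q - p' * q' \<in> I"
proof -
  have "p * q - p' * q' = p * (q - q') + (p - p') * q'" by (simp add: algebra_simps)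
  then show ?thesis
    using assms by (simp add: ideal.subspace_add ideal_mult_left ideal_mult_right)
qed

lemma ideal_diff_prod:
  assumes "is_ideal I" "\<And>i. i \<in> S \<Longrightarrow> f i - g i \<in> I"
  shows "prod f S - prod g S \<in> I"
  using assms(2)
  by (induction S rule: infinite_finite_induct)
     (auto simp: ideal.subspace_0[OF assms(1)] intro!: ideal_diff_mult[OF assms(1)])

lemma ideal_diff_power:
  assumes "is_ideal I" "p - q \<in> I"
  shows "p ^ n - q ^ n \<in> I"
  by (induction n) (auto simp: ideal.subspace_0[OF assms(1)] intro!: ideal_diff_mult assms)

text \<open>The binomial expansion to first order in \<open>z\<close>. For \<open>n = 0\<close> the
  truncated exponent \<open>n - 1\<close> comes with the coefficient 0.\<close>

lemma ideal_diff_power_square_zero: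
  assumes "is_ideal I" "z * z \<in> I"
  shows "(y + z) ^ n - (y ^ n + of_nat n * z * y ^ (n - 1)) \<in> I"
proof (induction n)
  case 0
  then show ?case by (simp add: ideal.subspace_0[OF assms(1)])
next
  case (Suc n)
  have "(y + z) ^ Suc n - (y ^ Suc n + of_nat (Suc n) * z * y ^ n) =
      (y + z) * ((y + z) ^ n - (y ^ n + of_nat n * z * y ^ (n - 1))) +
      of_nat n * y ^ (n - 1) * (z * z)"
    by (cases n) (simp_all add: algebra_simps)
  then show ?case
    using Suc by (simp add: ideal.subspace_add assms ideal_mult_left)
qed

text \<open>Modulo these monomials, only terms whose left factor divides \<open>x\<^sub>a\<^sup>m\<close> survive.\<close>

definition left_beyond :: "nat \<Rightarrow> nat \<Rightarrow> ((bool \<times> gen) \<Rightarrow>\<^sub>0 nat) set"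
  where "left_beyond a m = {k. \<exists>g. lookup (single (Tau a) m) g < lookup k (False, g)}"

lemma left_beyond_ideal: "is_ideal (monomial_ideal (left_beyond a m))"
  by (rule monomial_ideal_is_ideal)
     (force simp: up_closed_def left_beyond_def lookup_add intro: less_le_trans)

lemma Var_left_beyond:
  assumes "g = Tau a \<Longrightarrow> m < n" "n > 0"
  shows "Var False g ^ n \<in> monomial_ideal (left_beyond a m)"
  unfolding Var_power
  by (rule single_in_monomial_ideal)
     (use assms in \<open>auto simp: left_beyond_def lookup_single when_def intro!: exI[of _ g]\<close>)

text \<open>Raising to the power \<open>2 ^ n\<close> acts termwise. Each mixed term of the
  coproduct acquires the left exponent \<open>2 ^ Suc i * m\<close>, which exceeds \<open>m\<close>,
  and the left copy of \<open>g\<close> survives only for \<open>g = Tau a\<close>.\<close>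

lemma diagonal_gen_power:
  assumes "m = 2 ^ n"
  shows "diagonal_gen ((), g) ^ m - (Var True g ^ m + (if g = Tau a then Var False g ^ m else 0))
    \<in> monomial_ideal (left_beyond a m)" (is "_ \<in> ?M")
proof (cases g)
  case (Xi k)
  then show ?thesis by (simp add: ideal.subspace_0[OF left_beyond_ideal])
next
  case (Tau k)
  have "Const (tau ^ 2 ^ i) * Var False (Tau (k - Suc i)) ^ 2 ^ Suc i * Var True (Tau i) \<in>
    {p. p ^ m \<in> ?M}" for i
  proof -
    have "(1 :: nat) < 2 ^ Suc i" by (rule one_less_power) simp_all
    then have "m < 2 ^ Suc i * m" using assms by simp
    then have "Var False (Tau (k - Suc i)) ^ (2 ^ Suc i * m) \<in> ?M"
      by (intro Var_left_beyond) auto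
    then show ?thesis
      unfolding mem_Collect_eq power_mult_distrib power_mult[symmetric]
      by (intro ideal_mult_right[OF left_beyond_ideal] ideal_mult_left[OF left_beyond_ideal])
  qed
  then have "(\<Sum>i<k. Const (tau ^ 2 ^ i) * Var False (Tau (k - Suc i)) ^ 2 ^ Suc i * Var True (Tau i)) ^ m
      \<in> ?M" (is "?s ^ m \<in> _")
    unfolding assms power_2_power_sum[OF free_alg_two]
    by (intro ideal.subspace_sum[OF left_beyond_ideal]) auto
  moreover have "Var False (Tau k) ^ m - (if g = Tau a then Var False g ^ m else 0) \<in> ?M"
  proof (cases "k = a")
    case True
    then show ?thesis using Tau by (simp add: ideal.subspace_0[OF left_beyond_ideal])
  next
    case False
    then show ?thesis using Tau assms by (auto intro!: Var_left_beyond)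
  qed
  moreover have "diagonal_gen ((), g) ^ m = Var False (Tau k) ^ m + Var True (Tau k) ^ m + ?s ^ m"
    by (simp only: Tau diagonal_gen.simps assms power_2_power_add[OF free_alg_two])
  ultimately show ?thesis
    using ideal.subspace_add[OF left_beyond_ideal] Tau by (fastforce simp: algebra_simps)
qed

text \<open>All exponents are multiples of \<open>m\<close>, so only \<open>m\<close>-th powers of
  variables matter. Modulo the ideal, those of variables other than \<open>v\<close> pass to the
  right copy, and that of \<open>v\<close> becomes \<open>y + z\<close> with \<open>z * z\<close> in
  the ideal. The part linear in \<open>z\<close> has the coefficient
  \<open>lookup e v div m\<close>; if this is 0, the truncated difference
  \<open>e - single v m\<close> is harmless.\<close>

lemma eval_monom_diagonal_gen:
  fixes e :: "(unit \<times> gen) \<Rightarrow>\<^sub>0 nat" and a n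
  defines "m \<equiv> 2 ^ n" and "v \<equiv> ((), Tau a)"
  assumes dvd: "\<And>u. m dvd lookup e u"
  shows "eval_monom diagonal_gen e - (single (rename True e) 1 +
      of_nat (lookup e v div m) * single (rename False (single v m) + rename True (e - single v m)) 1)
    \<in> monomial_ideal (left_beyond a m)" (is "_ \<in> ?M")
proof -
  note M = left_beyond_ideal[of a m]
  let ?R = "\<lambda>(_ :: unit, g). Var True g"
  define e0 where "e0 = e - single v (lookup e v)"
  have e: "e = e0 + single v (lookup e v)"
    by (rule poly_mapping_eqI) (simp add: e0_def lookup_add lookup_minus lookup_single when_def)
  obtain r where r: "lookup e v = m * r" using dvd[of v] unfolding dvd_def by blast
  have m: "m > 0" by (simp add: m_def)
  have "diagonal_gen u ^ lookup e0 u - ?R u ^ lookup e0 u \<in> ?M" for u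
  proof (cases "u = v")
    case True
    then show ?thesis by (simp add: e0_def lookup_minus lookup_single ideal.subspace_0[OF M])
  next
    case False
    then obtain g where g: "u = ((), g)" "g \<noteq> Tau a" by (cases u) (auto simp: v_def)
    obtain q where q: "lookup e0 u = m * q"
      using dvd[of u] False by (auto simp: e0_def lookup_minus lookup_single elim: dvdE)
    have "diagonal_gen u ^ m - ?R u ^ m \<in> ?M"
      using diagonal_gen_power[OF m_def[THEN meta_eq_to_obj_eq], of g a] g by simp
    from ideal_diff_power[OF M this, of q] show ?thesis by (simp add: q power_mult)
  qed
  then have rest: "eval_monom diagonal_gen e0 - eval_monom ?R e0 \<in> ?M"
    unfolding eval_monom_def by (intro ideal_diff_prod[OF M]) auto
  define y z where "y = Var True (Tau a) ^ m" and "z = Var False (Tau a) ^ m"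
  have "Var False (Tau a) ^ (m + m) \<in> ?M" using m by (intro Var_left_beyond) auto
  then have "z * z \<in> ?M" by (simp add: z_def power_add)
  note square = ideal_diff_power_square_zero[OF M this, of y r]
  have "diagonal_gen v ^ m - (y + z) \<in> ?M"
    using diagonal_gen_power[OF m_def[THEN meta_eq_to_obj_eq], of "Tau a" a] by (simp add: v_def y_def z_def)
  from ideal_diff_power[OF M this, of r]
  have "diagonal_gen v ^ (m * r) - (y + z) ^ r \<in> ?M" by (simp add: power_mult)
  from ideal.subspace_add[OF M this square]
  have "diagonal_gen v ^ (m * r) - (y ^ r + of_nat r * z * y ^ (r - 1)) \<in> ?M"
    by (simp only: diff_add_cancel add_diff_eq)
  from ideal_diff_mult[OF M rest this]
  have "eval_monom diagonal_gen e - eval_monom ?R e0 * (y ^ r + of_nat r * z * y ^ (r - 1)) \<in> ?M"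
    by (subst e) (simp only: eval_monom_add eval_monom_single r)
  moreover have "eval_monom ?R e0 * y ^ r = single (rename True e) 1"
    unfolding eval_monom_rename[symmetric]
    by (subst e) (simp add: eval_monom_add eval_monom_single r y_def power_mult, simp add: v_def)
  moreover have "of_nat r * (eval_monom ?R e0 * z * y ^ (r - 1)) =
      of_nat r * single (rename False (single v m) + rename True (e - single v m)) 1"
  proof (cases r)
    case 0
    then show ?thesis by simp
  next
    case (Suc q)
    have "e - single v m = e0 + single v (m * q)"
    proof (rule poly_mapping_eqI)
      show "lookup (e - single v m) u = lookup (e0 + single v (m * q)) u" for u
        by (cases "u = v") (simp_all add: e0_def lookup_add lookup_minus lookup_single r Suc)
    qed
    then have "eval_monom ?R (e - single v m) = eval_monom ?R e0 * y ^ (r - 1)"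
      by (simp add: eval_monom_add eval_monom_single y_def v_def power_mult Suc)
    moreover have "z = single (rename False (single v m)) 1"
      by (simp add: z_def Var_power v_def rename_single)
    ultimately have "eval_monom ?R e0 * z * y ^ (r - 1) =
        single (rename False (single v m)) 1 * single (rename True (e - single v m)) 1"
      by (simp only: eval_monom_rename[symmetric] mult_ac)
    then show ?thesis by (simp add: mult_single)
  qed
  moreover have "lookup e v div m = r" using r m by simp
  ultimately show ?thesis by (simp add: algebra_simps)
qed

lemma of_nat_free_alg: "(of_nat n :: 's free_alg) = Const (of_nat n)"
  by (induction n) (simp_all add: is_ring_homD[OF Const_is_ring_hom])

text \<open>The left factor of \<open>?k\<close> is exactly \<open>x_a ^ m\<close>, so
  \<open>?k\<close> is not in \<open>left_beyond a m\<close> and the congruence becomes an equality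
  of coefficients there.\<close>

lemma lookup_eval_monom_diagonal_gen:
  fixes e f :: "(unit \<times> gen) \<Rightarrow>\<^sub>0 nat" and a n
  defines "m \<equiv> 2 ^ n" and "v \<equiv> ((), Tau a)"
  assumes dvd: "\<And>u. m dvd lookup e u"
  shows "lookup (eval_monom diagonal_gen e) (rename False (single v m) + rename True f) =
    (if f = e - single v m then of_nat (lookup e v div m) else 0)"
    (is "lookup _ ?k = _")
proof -
  have "lookup ?k (False, g) = lookup (single (Tau a) m) g" for g
    by (auto simp: lookup_add lookup_rename lookup_single v_def when_def)
  then have "?k \<notin> left_beyond a m" by (simp add: left_beyond_def)
  from lookup_monomial_ideal[OF eval_monom_diagonal_gen[OF dvd[unfolded m_def], of a, folded m_def v_def] this]
  have "lookup (eval_monom diagonal_gen e) ?k = lookup (single (rename True e) (1 :: M2)) ?k +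
      of_nat (lookup e v div m) *
      lookup (single (rename False (single v m) + rename True (e - single v m)) 1) ?k"
    by (simp add: lookup_minus lookup_add of_nat_free_alg lookup_Const_mult)
  moreover have "rename True e \<noteq> ?k"
  proof
    assume "rename True e = ?k"
    from arg_cong[OF this, of "\<lambda>k. lookup k (False, Tau a)"] show False
      by (simp add: lookup_add lookup_rename v_def m_def)
  qed
  ultimately show ?thesis
    by (auto simp: lookup_single when_def rename_eq_iff)
qed

text \<open>Monomials with exponent at least \<open>m\<close> at \<open>v\<close> are equal once
  they agree after removal of \<open>x_a ^ m\<close>, so only \<open>f\<close> contributes. Its
  multiplicity \<open>lookup f v div m\<close> is odd, that is, 1 in characteristic 2.\<close>

lemma lookup_diagonal:
  fixes p :: "unit free_alg" and a n
  defines "m \<equiv> 2 ^ n" and "v \<equiv> ((), Tau a)"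
  assumes dvd: "\<And>e u. e \<in> keys p \<Longrightarrow> m dvd lookup e u"
    and f: "f \<in> keys p" "\<not> 2 ^ Suc n dvd lookup f v"
  shows "lookup (diagonal p) (rename False (single v m) + rename True (f - single v m)) = lookup p f"
    (is "lookup _ ?k = _")
proof -
  have pos: "lookup e v \<ge> m" if "lookup e v div m \<noteq> 0" for e
    using that by (metis div_less not_le)
  have inj: "lookup p e * (if f - single v m = e - single v m then of_nat (lookup e v div m) else 0) =
      (if e = f then lookup p f else 0)" if "e \<in> keys p" for e
  proof -
    have odd: "odd (lookup f v div m)"
      using f dvd[OF f(1), of v] by (simp add: m_def dvd_div_iff_mult mult.commute)
    then have "of_nat (lookup f v div m) = (1 :: M2)"
      using M2_add_self[of 1] by (elim oddE) (simp add: mult_2 add.assoc[symmetric] flip: of_nat_mult)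
    moreover have "e = f" if "f - single v m = e - single v m" "lookup e v div m \<noteq> 0"
    proof -
      have "lookup f v div m \<noteq> 0" using odd by (metis even_zero)
      then have "lookup f v \<ge> m" "lookup e v \<ge> m" using pos that(2) by auto
      then have "f = (f - single v m) + single v m" "e = (e - single v m) + single v m"
        by (auto intro!: poly_mapping_eqI simp: lookup_add lookup_minus lookup_single when_def)
      then show ?thesis using that(1) by metis
    qed
    ultimately show ?thesis by (cases "lookup e v div m = 0") auto
  qed
  have "lookup (diagonal p) ?k = (\<Sum>e\<in>keys p. lookup p e *
      (if f - single v m = e - single v m then of_nat (lookup e v div m) else 0))"
    using dvd unfolding m_def v_def
    by (simp add: diagonal_def eval_poly_def lookup_sum lookup_Const_mult
        lookup_eval_monom_diagonal_gen)
  also have "\<dots> = (\<Sum>e\<in>keys p. if e = f then lookup p f else 0)"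
    by (rule sum.cong) (use inj in auto)
  finally show ?thesis using f(1) by simp
qed

subsection \<open>Degrees\<close>

text \<open>The first component of \<open>gen_bideg\<close>. It is positive on every generator,
  whereas the second one vanishes on \<open>Tau 0\<close>.\<close>

fun gen_degree :: "gen \<Rightarrow> nat" where
  "gen_degree (Tau i) = 2 ^ (i + 1) - 1"
| "gen_degree (Xi i) = 2 ^ (i + 2) - 2"

definition degree_monom :: "(('s \<times> gen) \<Rightarrow>\<^sub>0 nat) \<Rightarrow> nat"
  where "degree_monom e = (\<Sum>v\<in>keys e. lookup e v * gen_degree (snd v))"

lemma gen_degree_pos: "gen_degree g > 0"
proof (cases g)
  case (Tau i)
  then show ?thesis using one_less_power[of "2::nat" "i + 1"] by simp
next
  case (Xi i)
  then show ?thesis using one_less_power[of "2::nat" "i + 1"] by simp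
qed

lemma degree_monom_superset:
  assumes "finite S" "keys e \<subseteq> S"
  shows "degree_monom e = (\<Sum>v\<in>S. lookup e v * gen_degree (snd v))"
  unfolding degree_monom_def by (rule sum.mono_neutral_left) (use assms in \<open>auto simp: in_keys_iff\<close>)

lemma degree_monom_add: "degree_monom (e + f) = degree_monom e + degree_monom f"
  using degree_monom_superset[of "keys e \<union> keys f" "e + f"] degree_monom_superset[of "keys e \<union> keys f" e]
    degree_monom_superset[of "keys e \<union> keys f" f] Poly_Mapping.keys_add[of e f]
  by (simp add: lookup_add distrib_right sum.distrib)

lemma degree_monom_single: "degree_monom (single v n) = n * gen_degree (snd v)"
  by (subst degree_monom_superset[of "{v}"]) auto

lemma degree_monom_eq_0_iff: "degree_monom e = 0 \<longleftrightarrow> e = 0"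
proof
  assume "degree_monom e = 0"
  then have "lookup e v * gen_degree (snd v) = 0" if "v \<in> keys e" for v
    using that by (simp only: degree_monom_def sum_eq_0_iff[OF finite_keys])
  then have "keys e = {}"
    using gen_degree_pos by (metis equals0I in_keys_iff mult_eq_0_iff less_numeral_extra(3))
  then show "e = 0" by simp
qed (simp add: degree_monom_def)

lemma fst_monom_bideg: "fst (monom_bideg n e) = int (degree_monom e)"
proof -
  have "fst (gen_bideg g) = int (gen_degree g)" for g
    using gen_degree_pos[of g] by (cases g) (simp_all add: of_nat_diff)
  then show ?thesis by (simp add: monom_bideg_def degree_monom_def)
qed

definition homogeneous_part :: "nat \<Rightarrow> 's free_alg set"
  where "homogeneous_part d = {p. \<forall>e\<in>keys p. degree_monom e = d}"

lemma homogeneous_part_single: "degree_monom e = d \<Longrightarrow> single e c \<in> homogeneous_part d"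
  by (simp add: homogeneous_part_def)

lemma homogeneous_part_mult:
  "p \<in> homogeneous_part c \<Longrightarrow> q \<in> homogeneous_part d \<Longrightarrow> p * q \<in> homogeneous_part (c + d)"
  using Poly_Mapping.keys_mult[of p q] by (fastforce simp: homogeneous_part_def degree_monom_add)

lemma homogeneous_part_sum:
  assumes "\<And>i. i \<in> S \<Longrightarrow> f i \<in> homogeneous_part d"
  shows "sum f S \<in> homogeneous_part d"
proof -
  have "p + q \<in> homogeneous_part d" if "p \<in> homogeneous_part d" "q \<in> homogeneous_part d" for p q :: "'s free_alg"
    using that Poly_Mapping.keys_add[of p q] by (auto simp: homogeneous_part_def)
  moreover have "0 \<in> (homogeneous_part d :: 's free_alg set)" by (simp add: homogeneous_part_def)
  ultimately show ?thesis
    using assms by (induction S rule: infinite_finite_induct) auto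
qed

lemma homogeneous_part_one: "1 \<in> homogeneous_part 0"
  by (simp add: homogeneous_part_def degree_monom_def)

lemma homogeneous_part_power: "p \<in> homogeneous_part d \<Longrightarrow> p ^ n \<in> homogeneous_part (n * d)"
  by (induction n) (simp_all add: homogeneous_part_one homogeneous_part_mult)

lemma homogeneous_part_prod:
  "(\<And>i. i \<in> S \<Longrightarrow> f i \<in> homogeneous_part (d i)) \<Longrightarrow> prod f S \<in> homogeneous_part (sum d S)"
  by (induction S rule: infinite_finite_induct)
     (simp_all add: homogeneous_part_one homogeneous_part_mult)

lemma homogeneous_part_Const: "Const c \<in> homogeneous_part 0"
  unfolding Const_def by (rule homogeneous_part_single) (simp add: degree_monom_def)

text \<open>Scalars have degree 0 and \<open>Xi i\<close> has twice the degree of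
  \<open>Tau i\<close>, so \<open>to_poly\<close> preserves degrees.\<close>

lemma homogeneous_part_to_poly_gen: "to_poly_gen v \<in> homogeneous_part (gen_degree (snd v))"
proof -
  have Var: "Const tau * Var s (Tau i) ^ n \<in> homogeneous_part (0 + n * (2 ^ (i + 1) - 1))" for s i n
    unfolding Var_power
    by (intro homogeneous_part_mult homogeneous_part_Const homogeneous_part_single)
       (simp add: degree_monom_single)
  obtain s g where "v = (s, g)" by (cases v)
  then show ?thesis
    using Var[of s _ 1] Var[of s _ 2] by (cases g) (simp_all add: right_diff_distrib')
qed

lemma homogeneous_to_poly:
  assumes "homogeneous d x"
  obtains n where "to_poly x \<in> homogeneous_part n"
proof -
  obtain p where p: "x = abs_steenrod p"
    "\<And>m n. coeff (lookup p m) n \<noteq> 0 \<Longrightarrow> monom_bideg n m = d"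
    using assms unfolding homogeneous_def by blast
  have "Const (lookup p m) * eval_monom to_poly_gen m \<in> homogeneous_part (nat (fst d))"
    if "m \<in> keys p" for m
  proof -
    \<comment> \<open>The leading coefficient is nonzero, so homogeneity applies to it; the first
      component of the bidegree does not depend on the power of \<open>tau\<close>.\<close>
    have "monom_bideg (degree (lookup p m)) m = d"
      by (rule p(2)) (use that in \<open>simp add: in_keys_iff\<close>)
    then have "degree_monom m = nat (fst d)" using fst_monom_bideg[of _ m] by (metis nat_int)
    moreover have "Const (lookup p m) * eval_monom to_poly_gen m \<in> homogeneous_part (0 + degree_monom m)"
      unfolding eval_monom_def degree_monom_def
      by (intro homogeneous_part_mult homogeneous_part_Const homogeneous_part_prod
          homogeneous_part_power homogeneous_part_to_poly_gen)
    ultimately show ?thesis by simp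
  qed
  then have "to_poly x \<in> homogeneous_part (nat (fst d))"
    unfolding p(1) to_poly_def hom_ext_abs[OF to_poly_respects] eval_poly_def
    by (rule homogeneous_part_sum)
  then show thesis by (rule that)
qed

text \<open>Generators are homogeneous, so the \<open>M2\<close>-span of the homogeneous elements of
  \<open>I\<close> is already an ideal. Linear conditions on \<open>I\<close> can thus be tested on
  homogeneous elements.\<close>

lemma bigraded_ideal_spanned:
  assumes "bigraded_ideal I"
  shows "I \<subseteq> M2.span {x \<in> I. \<exists>d. to_poly x \<in> homogeneous_part d}"
proof -
  let ?X = "{x \<in> I. \<exists>d. to_poly x \<in> homogeneous_part d}"
  have I: "is_ideal I" "I = ideal_gen {x \<in> I. \<exists>d. homogeneous d x}"
    using assms by (auto simp: bigraded_ideal_def)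
  have "generator s g * x \<in> M2.span ?X" if x: "x \<in> ?X" for s g x
  proof (rule M2.span_base)
    show "generator s g * x \<in> ?X"
      using x ideal_mult_left[OF I(1)] homogeneous_part_mult[OF homogeneous_part_to_poly_gen]
      by (fastforce simp: is_ring_homD[OF to_poly_is_ring_hom] to_poly_generator)
  qed
  then have "is_ideal (M2.span ?X)" by (rule span_is_ideal)
  moreover have "x \<in> ?X" if "x \<in> I" "homogeneous d x" for x d
    using that(1) homogeneous_to_poly[OF that(2)] by blast
  then have "{x \<in> I. \<exists>d. homogeneous d x} \<subseteq> M2.span ?X"
    using M2.span_base by blast
  ultimately have "ideal_gen {x \<in> I. \<exists>d. homogeneous d x} \<subseteq> M2.span ?X"
    by (rule ideal.span_minimal[rotated])
  then show ?thesis using I(2) by simp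
qed


lemma single_key_eq_0_iff: "single v (n :: nat) = 0 \<longleftrightarrow> n = 0"
  by (metis lookup_single_eq lookup_zero single_zero)

lemma single_key_eq_iff: "(n :: nat) \<noteq> 0 \<Longrightarrow> single u n = single v n \<longleftrightarrow> u = v"
  by (metis lookup_single_eq lookup_single_not_eq)

subsection \<open>Free quotient Hopf algebras\<close>

text \<open>Multiply an expansion of \<open>x\<close> by \<open>c\<close>: independence gives
  \<open>c * d b = 0\<close>, and the ground ring is a domain.\<close>

lemma free_quotient_torsion_free:
  assumes "free_quotient scale I" "is_ideal I" "scale c x \<in> I" "c \<noteq> 0"
  shows "x \<in> I"
proof -
  obtain B where B: "\<forall>x. \<exists>F d. finite F \<and> F \<subseteq> B \<and> x - (\<Sum>b\<in>F. scale (d b) b) \<in> I"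
    and indep: "\<forall>F d. finite F \<and> F \<subseteq> B \<and> (\<Sum>b\<in>F. scale (d b) b) \<in> I \<longrightarrow> (\<forall>b\<in>F. d b = 0)"
    using assms(1) unfolding free_quotient_def by (elim exE conjE)
  obtain F d where F: "finite F" "F \<subseteq> B" "x - (\<Sum>b\<in>F. scale (d b) b) \<in> I"
    using B by meson
  have "scale c x - scale c (x - (\<Sum>b\<in>F. scale (d b) b)) \<in> I"
    by (intro ideal.subspace_diff assms ideal_scale F)
  then have "(\<Sum>b\<in>F. scale (c * d b) b) \<in> I"
    by (simp add: M2.scale_right_diff_distrib M2.scale_sum_right)
  with F(1,2) have "\<forall>b\<in>F. c * d b = 0"
    using indep[rule_format, of F "\<lambda>b. c * d b"] by simp
  then have "(\<Sum>b\<in>F. scale (d b) b) = 0"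
    using assms(4) by (intro sum.neutral) auto
  then show ?thesis using F(3) by simp
qed

lemma counit_scale: "counit (scale c x) = c * counit x"
  by (simp add: scale_def is_ring_homD[OF counit_is_ring_hom] counit_of_M2)

lemma basis_elem_single:
  "basis_elem (single v n) = basis_factor v n"
  by (cases "n = 0") (simp_all add: basis_elem_def basis_factor_0)

text \<open>
  The Milnor--Moore argument: modulo the profile ideal, a homogeneous element of \<open>I\<close> of minimal
  degree is primitive, and its exponents being multiples of \<open>2^n\<close> but not all of \<open>2^(n+1)\<close>,
  the coproduct has a coefficient which shows that it is a multiple of some \<open>x\<^sub>a^(2^n)\<close>.
\<close>

lemma hopf_ideal_lookup_eq_0:
  assumes hopf: "hopf_ideal I" and freeI: "free_quotient scale I"
    and profile: "free_profile h k" "profile_ideal h k \<subseteq> I"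
    and h: "\<And>i n. i \<ge> 1 \<Longrightarrow> xi i ^ 2 ^ n \<in> I \<Longrightarrow> h i \<le> enat n"
    and k: "\<And>j. taui j \<in> I \<Longrightarrow> k j = 0"
    and "u \<in> I" "e \<notin> truncated (height h k)"
  shows "lookup (to_poly u) e = 0"
  using assms(7,8)
proof (induction "degree_monom e" arbitrary: e u rule: less_induct)
  case (less e)
  let ?U = "truncated (height h k)"
  have I: "is_ideal I" and bigraded: "bigraded_ideal I"
    and psi: "\<And>x. x \<in> I \<Longrightarrow> psi x \<in> tensor_ideal I"
    and counit: "\<And>x. x \<in> I \<Longrightarrow> counit x = 0"
    using hopf by (auto simp: hopf_ideal_def bigraded_ideal_def tensor_ideal_def)
  \<comment> \<open>Homogeneous elements suffice, since they span \<open>I\<close> and taking a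
    coefficient is linear.\<close>
  have homogeneous: "lookup (to_poly u) e = 0" if u: "u \<in> I" "to_poly u \<in> homogeneous_part d" for u d
  proof (rule ccontr)
    assume nz: "lookup (to_poly u) e \<noteq> 0"
    then have d: "degree_monom e = d" using u(2) by (auto simp: homogeneous_part_def in_keys_iff)
    obtain F c where F: "finite F" "\<And>f. f \<in> F \<Longrightarrow> tau_monom f"
      "u = (\<Sum>f\<in>F. scale (c f) (basis_elem f))"
      using basis_expansion[of u] by blast
    have lookup_u: "lookup (to_poly u) f = (if f \<in> F then c f * tau ^ weight f else 0)" for f
      unfolding F(3) by (rule lookup_to_poly_expansion[OF F(1,2)])
    \<comment> \<open>Terms from the profile ideal are discarded. They lie in \<open>I\<close>,
      hence so does the remainder \<open>u'\<close>, and \<open>G\<close> is exactly the set of its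
      monomials.\<close>
    define G where "G = {f \<in> F. f \<notin> ?U \<and> c f \<noteq> 0}"
    have G: "finite G" "\<And>f. f \<in> G \<Longrightarrow> tau_monom f" using F by (auto simp: G_def)
    define u' where "u' = (\<Sum>f\<in>G. scale (c f) (basis_elem f))"
    have "(\<Sum>f\<in>F - G. scale (c f) (basis_elem f)) \<in> I"
    proof (rule ideal.subspace_sum[OF I])
      fix f assume "f \<in> F - G"
      then consider "f \<in> ?U" | "c f = 0" by (auto simp: G_def)
      then show "scale (c f) (basis_elem f) \<in> I"
      proof cases
        case 1
        then show ?thesis
          using basis_elem_in_profile_ideal[OF profile(1)] profile(2) by (intro ideal_scale[OF I]) blast
      qed (simp add: ideal.subspace_0[OF I])
    qed
    moreover have "u = u' + (\<Sum>f\<in>F - G. scale (c f) (basis_elem f))"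
      unfolding F(3) u'_def using F(1) by (subst add.commute, intro sum.subset_diff) (auto simp: G_def)
    ultimately have u': "u' \<in> I"
      using ideal.subspace_diff[OF I u(1)] by fastforce
    have lookup_u': "lookup (to_poly u') f = (if f \<in> G then c f * tau ^ weight f else 0)" for f
      unfolding u'_def by (rule lookup_to_poly_expansion[OF G])
    have coeff: "c f * tau ^ weight f \<noteq> 0" if "f \<in> G" for f
      using that tau_nonzero by (simp add: G_def)
    have keys: "keys (to_poly u') = G"
      using coeff by (auto simp only: in_keys_iff lookup_u' split: if_splits)
    have "e \<in> F \<and> c e \<noteq> 0" using nz unfolding lookup_u[of e] by (auto split: if_splits)
    then have e: "e \<in> G" using less.prems(2) by (simp add: G_def)
    have degree: "degree_monom f = d" if "f \<in> G" for f
    proof -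
      have "f \<in> F" using that by (simp add: G_def)
      then have "f \<in> keys (to_poly u)" using coeff[OF that] by (simp add: in_keys_iff lookup_u)
      then show ?thesis using u(2) by (simp add: homogeneous_part_def)
    qed
    have reduced: "f \<notin> ?U" if "f \<in> G" for f using that by (simp add: G_def)
    \<comment> \<open>In degree 0 the element \<open>u'\<close> is a scalar, which the counit
      detects.\<close>
    have "e \<noteq> 0"
    proof
      assume "e = 0"
      then have "d = 0" using d degree_monom_eq_0_iff[of e] by simp
      then have "f = 0" if "f \<in> G" for f using degree[OF that] by (simp add: degree_monom_eq_0_iff)
      then have "G = {0}" using e \<open>e = 0\<close> by blast
      then have "counit u' = c 0" by (simp add: u'_def counit_scale basis_elem_def
            is_ring_homD[OF counit_is_ring_hom])
      then show False using counit[OF u'] e \<open>e = 0\<close> by (simp add: G_def)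
    qed
    \<comment> \<open>For the least \<open>n\<close> with \<open>P n\<close>, the number
      \<open>2 ^ n\<close> is the largest power of 2 dividing all exponents in
      \<open>G\<close>.\<close>
    define P where "P n \<longleftrightarrow> (\<exists>f\<in>G. \<exists>v. \<not> 2 ^ Suc n dvd lookup f v)" for n :: nat
    obtain w where w: "lookup e w \<noteq> 0" using \<open>e \<noteq> 0\<close> by (metis lookup_zero poly_mapping_eqI)
    have "lookup e w < 2 ^ Suc (lookup e w)" by (rule less_trans[OF lessI less_exp])
    then have "\<not> 2 ^ Suc (lookup e w) dvd lookup e w" using w by (auto dest: dvd_imp_le)
    then have "P (lookup e w)" using e unfolding P_def by blast
    define n where "n = (LEAST n. P n)"
    define m where "m = (2 :: nat) ^ n"
    have "P n" using \<open>P (lookup e w)\<close> unfolding n_def by (rule LeastI)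
    have dvd: "m dvd lookup f v" if "f \<in> G" for f v
    proof (cases n)
      case (Suc n')
      then have "\<not> P n'" using not_less_Least[of n' P] by (simp add: n_def)
      then show ?thesis using that unfolding P_def Suc m_def by blast
    qed (simp add: m_def)
    \<comment> \<open>Otherwise \<open>f\<close> splits into \<open>x_a ^ m\<close> and a cofactor,
      both reduced and of smaller degree. By induction their coefficients vanish on
      \<open>I\<close>, so the corresponding coefficient of \<open>psi u'\<close> is 0; by
      \<open>lookup_diagonal\<close> it is the nonzero coefficient of \<open>f\<close> in
      \<open>u'\<close>.\<close>
    have pure: "f = single v m" if f: "f \<in> G" "\<not> 2 ^ Suc n dvd lookup f v" for f v
    proof (rule ccontr)
      assume ne: "f \<noteq> single v m"
      have nz: "lookup f v \<noteq> 0" using f(2) by (intro notI) simp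
      then have "v \<in> keys f" by (simp add: in_keys_iff)
      obtain a where a: "v = ((), Tau a)"
        using tau_monom_keys[OF G(2)[OF f(1)] \<open>v \<in> keys f\<close>] by auto
      have "m \<le> lookup f v" using dvd[OF f(1), of v] nz by (auto dest: dvd_imp_le)
      then have sum: "f = single v m + (f - single v m)"
        by (intro poly_mapping_eqI) (auto simp: lookup_add lookup_minus lookup_single when_def)
      have deg: "d = degree_monom (single v m) + degree_monom (f - single v m)"
        using degree[OF f(1)] by (subst (asm) sum) (simp only: degree_monom_add)
      have "f - single v m \<noteq> 0" using sum ne by (metis add.right_neutral)
      then have "degree_monom (single v m) \<noteq> 0" "degree_monom (f - single v m) \<noteq> 0"
        by (simp_all add: degree_monom_eq_0_iff m_def single_key_eq_0_iff)
      then have "degree_monom (single v m) < degree_monom e" "degree_monom (f - single v m) < degree_monom e"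
        using deg d by auto
      moreover have "single v m \<notin> ?U" "f - single v m \<notin> ?U"
        using truncated_add[of "single v m" "f - single v m" "height h k"] reduced[OF f(1)]
        unfolding sum[symmetric] by blast+
      ultimately have "lookup (to_poly (psi u')) (rename False (single v m) + rename True (f - single v m)) = 0"
        by (intro lookup_tensor_ideal[OF psi[OF u']] less.hyps) auto
      moreover have "lookup (diagonal (to_poly u')) (rename False (single v m) + rename True (f - single v m)) =
          lookup (to_poly u') f"
        unfolding m_def a by (rule lookup_diagonal) (use dvd f keys in \<open>auto simp: m_def a\<close>)
      moreover have "lookup (to_poly u') f \<noteq> 0" using f(1) unfolding keys[symmetric] in_keys_iff .
      ultimately show False by (simp add: to_poly_psi)
    qed
    obtain f v where f: "f \<in> G" "\<not> 2 ^ Suc n dvd lookup f v" using \<open>P n\<close> unfolding P_def by blast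
    have f_eq: "f = single v m" by (rule pure[OF f])
    obtain a where a: "v = ((), Tau a)"
      using tau_monom_keys[OF G(2)[OF f(1)], of v] by (auto simp: f_eq m_def)
    have d_eq: "d = m * (2 ^ Suc a - 1)"
      using degree[OF f(1)] by (simp add: f_eq a degree_monom_single)
    \<comment> \<open>Either \<open>g\<close> is also a pure power \<open>x_b ^ m\<close>, and
      equality of degrees gives \<open>b = a\<close>, or \<open>2 ^ Suc n\<close> divides the degree
      \<open>m * (2 ^ Suc a - 1)\<close>, whose second factor is odd.\<close>
    have "g = f" if g: "g \<in> G" for g
    proof (cases "\<exists>w. \<not> 2 ^ Suc n dvd lookup g w")
      case True
      then obtain w where w: "g = single w m" using pure[OF g] by blast
      obtain b where b: "w = ((), Tau b)"
        using tau_monom_keys[OF G(2)[OF g], of w] by (auto simp: w m_def)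
      have "m * (2 ^ Suc b - 1) = m * (2 ^ Suc a - 1)"
        using degree[OF g] d_eq by (simp add: w b degree_monom_single)
      then have "(2::nat) ^ Suc b - 1 = 2 ^ Suc a - 1" by (simp add: m_def)
      moreover have "(1::nat) \<le> 2 ^ Suc a" "(1::nat) \<le> 2 ^ Suc b" by (rule one_le_power, simp)+
      ultimately have "(2::nat) ^ Suc b = 2 ^ Suc a" by linarith
      then show ?thesis by (simp add: w b f_eq a)
    next
      case False
      then have "2 ^ Suc n dvd degree_monom g"
        unfolding degree_monom_def by (blast intro: dvd_sum dvd_mult2)
      then have "m * 2 dvd m * (2 ^ Suc a - 1)"
        using degree[OF g] d_eq by (simp add: m_def mult.commute)
      then have "2 dvd (2::nat) ^ Suc a - 1" by (simp add: m_def)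
      then show ?thesis by simp
    qed
    then have "G = {f}" using f(1) by blast
    then have "scale (c f) (basis_elem f) \<in> I" using u' by (simp add: u'_def)
    then have basis: "basis_factor v m \<in> I"
      using free_quotient_torsion_free[OF freeI I] f(1) by (simp add: G_def f_eq basis_elem_single)
    \<comment> \<open>The element \<open>basis_factor v m\<close> is \<open>taui a\<close> for
      \<open>n = 0\<close> and \<open>xi (Suc a) ^ 2 ^ n'\<close> for \<open>n = Suc n'\<close>, so
      its membership in \<open>I\<close> bounds the height.\<close>
    have "height h k a \<le> enat n"
    proof (cases n)
      case 0
      then have "k a = 0" using basis k by (simp add: m_def a taui_generator)
      then show ?thesis by (simp add: height_def)
    next
      case (Suc n')
      then have "h (Suc a) \<le> enat n'" using basis h[of "Suc a" n'] by (simp add: m_def a xi_generator)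
      then have "eSuc (h (Suc a)) \<le> enat n" by (metis Suc eSuc_enat eSuc_ile_mono)
      then show ?thesis by (simp add: height_def)
    qed
    then have "f \<in> ?U" by (rule truncatedI[where s = "()"]) (simp add: f_eq a m_def)
    then show False using reduced[OF f(1)] by simp
  qed
  have "M2.subspace {u. lookup (to_poly u) e = 0}"
    by (rule M2.subspaceI)
       (simp_all add: is_ring_homD[OF to_poly_is_ring_hom] to_poly_scale lookup_add lookup_Const_mult)
  then have "M2.span {x \<in> I. \<exists>d. to_poly x \<in> homogeneous_part d} \<subseteq> {u. lookup (to_poly u) e = 0}"
    by (rule M2.span_minimal[rotated]) (use homogeneous in blast)
  then show ?case using bigraded_ideal_spanned[OF bigraded] less.prems(1) by blast
qed

section \<open>Necessity of the two inequalities\<close>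

lemma to_poly_xi_power:
  "to_poly (xi (Suc i) ^ 2 ^ n) = single (single ((), Tau i) (2 ^ Suc n)) (tau ^ 2 ^ n)"
proof -
  have "to_poly (xi (Suc i) ^ 2 ^ n) = Const (tau ^ 2 ^ n) * Var () (Tau i) ^ 2 ^ Suc n"
    by (simp add: is_ring_homD[OF to_poly_is_ring_hom] to_poly_xi power_mult_distrib Const_power
        flip: power_mult)
  then show ?thesis by (simp add: Var_power Const_def mult_single)
qed

lemma truncated_single:
  assumes "single ((), Tau i) (2 ^ n) \<in> truncated \<kappa>"
  shows "\<kappa> i \<le> enat n"
proof -
  obtain j m where "\<kappa> j = enat m" "2 ^ m \<le> lookup (single ((), Tau i) ((2::nat) ^ n)) ((), Tau j)"
    using assms unfolding truncated_def by auto
  then show ?thesis by (cases "i = j") (auto simp: lookup_single)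
qed

lemma height_Suc_le: "free_profile h k \<Longrightarrow> height h k i \<le> enat (Suc n) \<Longrightarrow> h (Suc i) \<le> enat n"
  using free_profileD(1)[of h k i]
  by (cases "h (Suc i)") (auto simp: height_def eSuc_enat zero_enat_def split: if_splits)

lemma height_le_0: "height h k i \<le> 0 \<Longrightarrow> k i = 0"
  by (auto simp: height_def split: if_splits)

lemma lookup_tensor_profile_ideal:
  assumes "free_profile h k" "z \<in> tensor_ideal (profile_ideal h k)"
    "lookup (to_poly z) (rename False e + rename True f) \<noteq> 0"
  shows "e \<in> truncated (height h k) \<or> f \<in> truncated (height h k)"
proof (rule ccontr)
  assume "\<not> ?thesis"
  then have "lookup (to_poly z) (rename False e + rename True f) = 0"
    by (intro lookup_tensor_ideal[OF assms(2)])
       (auto simp: in_profile_ideal_iff[OF assms(1)] intro: lookup_monomial_ideal)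
  then show False using assms(3) by simp
qed

text \<open>A single term of the coproduct of a generator contributes to a suitable coefficient,
  which is therefore a nonzero power of \<open>tau\<close>. One of the two monomials concerned must
  then be truncated, and this bounds \<open>h\<close> or \<open>k\<close>.\<close>

lemma profile_conditions:
  assumes free: "free_profile h k" and hopf: "hopf_ideal (profile_ideal h k)"
  shows "i \<ge> 1 \<Longrightarrow> j \<ge> 1 \<Longrightarrow> h i \<le> enat j + h (i + j) \<or> h j \<le> h (i + j)"
    and "i \<ge> 1 \<Longrightarrow> k (i + j) = 0 \<Longrightarrow> h i \<le> enat j \<or> k j = 0"
proof -
  have psi: "psi x \<in> tensor_ideal (profile_ideal h k)" if "x \<in> profile_ideal h k" for x
    using hopf that by (auto simp: hopf_ideal_def tensor_ideal_def)
  note hom = is_ring_homD[OF to_poly_is_ring_hom]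
  {
    assume "i \<ge> 1" "j \<ge> 1"
    then obtain a b where ab: "i = Suc a" "j = Suc b" by (metis not0_implies_Suc not_one_le_zero)
    show "h i \<le> enat j + h (i + j) \<or> h j \<le> h (i + j)"
    proof (cases "h (i + j)")
      case (enat n)
      \<comment> \<open>The monomials of \<open>xi i ^ 2 ^ (j + n)\<close> and
        \<open>xi j ^ 2 ^ n\<close>, the two factors of the term with index
        \<open>j\<close>.\<close>
      let ?e = "single ((), Tau a) (2 ^ Suc (j + n))" and ?f = "single ((), Tau b) (2 ^ Suc n)"
      have "lookup (to_poly (xi c ^ 2 ^ n)) ?f = (if c = j then tau ^ 2 ^ n else 0)" for c
      proof (cases c)
        case 0
        then show ?thesis
          using ab by (simp add: xi_0 hom lookup_one when_def single_key_eq_0_iff)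
      qed (simp add: to_poly_xi_power lookup_single when_def ab single_key_eq_iff del: power_Suc)
      then have "lookup (to_poly (psi (xi (i + j) ^ 2 ^ n))) (rename False ?e + rename True ?f) =
          (\<Sum>c\<le>i + j. lookup (to_poly (xi (i + j - c) ^ 2 ^ (c + n))) ?e * (if c = j then tau ^ 2 ^ n else 0))"
        by (simp add: psi_xi_power hom lookup_sum lookup_to_poly_tensor)
      also have "\<dots> = lookup (to_poly (xi i ^ 2 ^ (j + n))) ?e * tau ^ 2 ^ n"
        by (simp add: if_distrib[of "(*) _"] cong: if_cong)
      also have "\<dots> \<noteq> 0"
        by (simp add: ab(1) to_poly_xi_power tau_nonzero del: power_Suc)
      finally have nz: "lookup (to_poly (psi (xi (i + j) ^ 2 ^ n))) (rename False ?e + rename True ?f) \<noteq> 0" .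
      have "xi (i + j) ^ 2 ^ n \<in> profile_ideal h k"
        using enat \<open>i \<ge> 1\<close> by (intro xi_in_profile_ideal) auto
      from lookup_tensor_profile_ideal[OF free psi[OF this] nz]
      have "?e \<in> truncated (height h k) \<or> ?f \<in> truncated (height h k)" .
      then have "h i \<le> enat (j + n) \<or> h j \<le> enat n"
        unfolding ab using truncated_single height_Suc_le[OF free] by blast
      then show ?thesis by (simp add: enat)
    qed simp
  }
  {
    assume "i \<ge> 1" "k (i + j) = 0"
    then obtain a where a: "i = Suc a" by (metis not0_implies_Suc not_one_le_zero)
    \<comment> \<open>The monomials of \<open>xi i ^ 2 ^ j\<close> and \<open>taui j\<close>; the
      exponent 1 is written \<open>2 ^ 0\<close> to fit \<open>truncated_single\<close>.\<close>
    let ?e = "single ((), Tau a) (2 ^ Suc j)" and ?f = "single ((), Tau j) (2 ^ 0 :: nat)"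
    have taui: "lookup (to_poly (taui c)) ?f = (if c = j then tau else 0)" for c
      using Var_power[of "()" "Tau c" 1]
      by (auto simp: to_poly_taui lookup_Const_mult lookup_single when_def single_key_eq_iff)
    \<comment> \<open>This excludes the extra term \<open>tensor (taui (i + j)) 1\<close>, whose
      right factor is 1.\<close>
    have "?f \<noteq> 0" by (simp add: single_key_eq_0_iff)
    then have "lookup (to_poly (psi (taui (i + j)))) (rename False ?e + rename True ?f) =
        (\<Sum>c\<le>i + j. lookup (to_poly (xi (i + j - c) ^ 2 ^ c)) ?e * (if c = j then tau else 0))"
      by (simp add: psi_taui hom lookup_add lookup_sum lookup_to_poly_tensor taui lookup_one when_def
          del: power_0)
    also have "\<dots> = lookup (to_poly (xi i ^ 2 ^ j)) ?e * tau"
      by (simp add: if_distrib[of "(*) _"] cong: if_cong)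
    also have "\<dots> \<noteq> 0"
      by (simp add: a to_poly_xi_power tau_nonzero del: power_Suc)
    finally have nz: "lookup (to_poly (psi (taui (i + j)))) (rename False ?e + rename True ?f) \<noteq> 0" .
    from lookup_tensor_profile_ideal[OF free psi[OF taui_in_profile_ideal[of k, OF \<open>k (i + j) = 0\<close>]] nz]
    have "?e \<in> truncated (height h k) \<or> ?f \<in> truncated (height h k)" .
    then show "h i \<le> enat j \<or> k j = 0"
      unfolding a using truncated_single height_Suc_le[OF free] height_le_0
      by (metis zero_enat_def)
  }
qed

theorem theoremA:
  fixes I :: "dual_steenrod set"
  shows "hopf_ideal I \<and> free_quotient scale I \<longleftrightarrow>
    (\<exists>h k. free_profile h k \<and>
       (\<forall>i\<ge>1. \<forall>j\<ge>1. h i \<le> enat j + h (i + j) \<or> h j \<le> h (i + j)) \<and>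
       (\<forall>i\<ge>1. \<forall>j. h i \<le> enat j + k (i + j) \<or> k j \<le> k (i + j)) \<and>
       I = profile_ideal h k)"
proof
  assume "hopf_ideal I \<and> free_quotient scale I"
  then have hopf: "hopf_ideal I" and freeI: "free_quotient scale I" by auto
  then have I: "is_ideal I" by (simp add: hopf_ideal_def bigraded_ideal_def)
  define h where "h i = (if \<exists>n. xi i ^ 2 ^ n \<in> I then enat (LEAST n. xi i ^ 2 ^ n \<in> I) else \<infinity>)" for i
  \<comment> \<open>Higher powers of \<open>taui j\<close> in \<open>I\<close> are accounted for by
    \<open>h\<close>: \<open>taui j ^ 2 ^ Suc n\<close> is a power of \<open>tau\<close> times
    \<open>xi (Suc j) ^ 2 ^ n\<close>, and torsion freeness cancels that scalar.\<close>
  define k :: "nat \<Rightarrow> enat" where "k j = (if taui j \<in> I then 0 else \<infinity>)" for j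
  have h_le: "h i \<le> enat n" if "xi i ^ 2 ^ n \<in> I" for i n
    using that by (auto simp: h_def intro: Least_le)
  have h_eq: "xi i ^ 2 ^ n \<in> I" if "h i = enat n" for i n
    using that by (auto simp: h_def split: if_splits intro: LeastI)
  have k_eq: "k j = 0 \<longleftrightarrow> taui j \<in> I" for j by (simp add: k_def)
  have free: "free_profile h k"
    unfolding free_profile_def
  proof (intro allI conjI impI)
    fix i
    assume "k i = 0"
    \<comment> \<open>The squaring relation puts \<open>tau\<close> times \<open>xi (Suc i)\<close>
      into \<open>I\<close>, and torsion freeness cancels \<open>tau\<close>.\<close>
    then have "taui i ^ 2 \<in> I"
      using ideal_mult_left[OF I] by (simp add: k_eq power2_eq_square)
    then have "scale tau (xi (Suc i)) \<in> I" by (simp add: taui_square scale_def)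
    then have "xi (Suc i) \<in> I"
      using free_quotient_torsion_free[OF freeI I] tau_nonzero by blast
    then show "h (i + 1) = 0" using h_le[of "i + 1" 0] by (simp add: zero_enat_def[symmetric])
  qed (auto simp: k_def)
  have le: "profile_ideal h k \<subseteq> I"
    by (rule profile_ideal_least[OF free I]) (use h_eq k_eq in auto)
  have "to_poly u \<in> monomial_ideal (truncated (height h k))" if "u \<in> I" for u
    using hopf_ideal_lookup_eq_0[OF hopf freeI free le h_le] k_eq that
    by (fastforce simp: monomial_ideal_def in_keys_iff)
  then have I_eq: "I = profile_ideal h k"
    using le in_profile_ideal_iff[OF free] by blast
  note conditions = profile_conditions[OF free hopf[unfolded I_eq]]
  have "h i \<le> enat j + k (i + j) \<or> k j \<le> k (i + j)" if "i \<ge> 1" for i j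
  proof (cases "k (i + j) = 0")
    case True
    then show ?thesis using conditions(2)[OF that True] by simp
  next
    case False
    then have "k (i + j) = \<infinity>" by (simp add: k_def split: if_splits)
    then show ?thesis by simp
  qed
  then show "\<exists>h k. free_profile h k \<and>
       (\<forall>i\<ge>1. \<forall>j\<ge>1. h i \<le> enat j + h (i + j) \<or> h j \<le> h (i + j)) \<and>
       (\<forall>i\<ge>1. \<forall>j. h i \<le> enat j + k (i + j) \<or> k j \<le> k (i + j)) \<and>
       I = profile_ideal h k"
    using free conditions(1) I_eq by blast
next
  assume "\<exists>h k. free_profile h k \<and>
       (\<forall>i\<ge>1. \<forall>j\<ge>1. h i \<le> enat j + h (i + j) \<or> h j \<le> h (i + j)) \<and>
       (\<forall>i\<ge>1. \<forall>j. h i \<le> enat j + k (i + j) \<or> k j \<le> k (i + j)) \<and>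
       I = profile_ideal h k"
  then show "hopf_ideal I \<and> free_quotient scale I"
    using profile_ideal_hopf_ideal profile_ideal_free_quotient by blast
qed

end
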